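(* Let $d\ge1$ and let $\{M_n\}_{n\in\mathbb N^d}$ be a stationary orthomartingale with respect to a commuting filtration $\{\mathcal F_n\}_{n\in\mathbb Z_+^d}$, with orthomartingale differences $\{D_n\}_{n\in\mathbb N^d}$ satisfying $\mathbb E D_{\mathbf 1}^2<\infty$. Then the family $$\left\{\frac{M_{t\cdot n}}{|n|^{1/2}}\right\}_{t\in[0,1]^d},\qquad n\in\mathbb N^d,$$ is tight in $D[0,1]^d$, in the sense that for all $\epsilon>0$, $$\lim_{\delta\downarrow0}\ \limsup_{n\to\infty}\ \mathbb P\left(\sup_{\substack{s,t\in[0,1]^d\\ \|s-t\|_\infty<\delta}}\frac{|M_{s\cdot n}-M_{t\cdot n}|}{|n|^{1/2}}>\epsilon\right)=0 .$$
   Context: Let $(\Omega,\mathcal F,\mathbb P)$ be a probability space, $\mathbb N=\{1,2,\dots\}$, $\mathbb Z_+=\{0\}\cup\mathbb N$. Order relations and $\wedge$ on $\mathbb Z^d$ are coordinatewise; $\mathbf 1=(1,\dots,1)$; $|n|=\prod_{q=1}^dn_q$; $t\cdot n=(t_1n_1,\dots,t_dn_d)$; $M_t=M_{\lfloor t\rfloor}$ for $t\in[0,\infty)^d$ with coordinatewise integer part; $n\to\infty$ means $n_q\to\infty$ for every $q=1,\dots,d$. A family of sub-$\sigma$-algebras $\{\mathcal F_i\}_{i\in\mathbb Z_+^d}$ of $\mathcal F$ is a filtration if $\mathcal F_i\subset\mathcal F_j$ whenever $i\le j$; it is commuting if in addition, for all $k,\ell\in\mathbb Z_+^d$ and every bounded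 $\mathcal F_\ell$-measurable random variable $Y$, $\mathbb E(Y\mid\mathcal F_k)=\mathbb E(Y\mid\mathcal F_{k\wedge\ell})$ almost surely. $\{M_n\}_{n\in\mathbb N^d}$ is an orthomartingale with respect to a commuting filtration $\{\mathcal F_i\}_{i\in\mathbb Z_+^d}$ if each $M_n$ is $\mathcal F_n$-measurable with $\mathbb E|M_n|<\infty$ and, with the convention $M_n\equiv0$ if $\min\{n_1,\dots,n_d\}=0$, $\mathbb E(M_j\mid\mathcal F_i)=M_i$ for all $i,j\in\mathbb Z_+^d$, $i\le j$. Its orthomartingale differences are the (unique) random variables $\{D_n\}_{n\in\mathbb N^d}$ with $M_n=\sum_{\mathbf 1\le i\le n}D_i$ for all $n\in\mathbb N^d$. The orthomartingale is called stationary if $\{D_n\}_{n\in\mathbb N^d}$ is strictly stationary. *)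

theory Defs
  imports "HOL-Probability.Probability"
begin

text \<open>
  The dimension is the cardinality of the index type \<open>'d\<close>. Elements of \<open>nat ^ 'd\<close> are the
  multi-indices in $\mathbb{Z}_+^d$, and \<open>1 \<le> n\<close> says that \<open>n\<close> lies in $\mathbb{N}^d$;
  \<open>\<le>\<close>, \<open>+\<close> and \<open>1\<close> on vectors are coordinatewise in the library.
\<close>

definition idx_meet :: "nat ^ 'd \<Rightarrow> nat ^ 'd \<Rightarrow> nat ^ 'd" where
  "idx_meet k l = (\<chi> q. min (k $ q) (l $ q))"

definition idx_size :: "nat ^ 'd::finite \<Rightarrow> nat" where
  "idx_size n = (\<Prod>q\<in>UNIV. n $ q)"

definition idx_scale :: "real ^ 'd \<Rightarrow> nat ^ 'd \<Rightarrow> real ^ 'd" where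
  "idx_scale t n = (\<chi> q. t $ q * real (n $ q))"

text \<open>\<open>nat\<close> truncates negative integers; only nonnegative vectors are relevant.\<close>

definition idx_floor :: "real ^ 'd \<Rightarrow> nat ^ 'd" where
  "idx_floor t = (\<chi> q. nat \<lfloor>t $ q\<rfloor>)"

text \<open>The filter of the limit $n \to \infty$: every coordinate tends to infinity.\<close>

definition idx_at_top :: "(nat ^ 'd::finite) filter" where
  "idx_at_top = (INF q. filtercomap (\<lambda>n. n $ q) at_top)"

text \<open>
  A sub-sigma-algebra is given as a measure of which only the space and the measurable sets matter.
\<close>

definition multi_filtration :: "'a measure \<Rightarrow> (nat ^ 'd::finite \<Rightarrow> 'a measure) \<Rightarrow> bool" where
  "multi_filtration P F \<longleftrightarrow>
     (\<forall>i. subalgebra P (F i)) \<and> (\<forall>i j. i \<le> j \<longrightarrow> sets (F i) \<subseteq> sets (F j))"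

definition commuting_filtration :: "'a measure \<Rightarrow> (nat ^ 'd::finite \<Rightarrow> 'a measure) \<Rightarrow> bool" where
  "commuting_filtration P F \<longleftrightarrow>
     multi_filtration P F \<and>
     (\<forall>k l. \<forall>Y :: 'a \<Rightarrow> real.
        Y \<in> borel_measurable (F l) \<and> (\<exists>C. \<forall>\<omega>\<in>space P. \<bar>Y \<omega>\<bar> \<le> C) \<longrightarrow>
        (AE \<omega> in P. real_cond_exp P (F k) Y \<omega> = real_cond_exp P (F (idx_meet k l)) Y \<omega>))"

text \<open>
  The family \<open>M\<close> is indexed by all of $\mathbb{Z}_+^d$; the convention that it vanishes when some
  coordinate of the index is 0 is the first conjunct.
\<close>

definition orthomartingale ::
    "'a measure \<Rightarrow> (nat ^ 'd::finite \<Rightarrow> 'a measure) \<Rightarrow> (nat ^ 'd \<Rightarrow> 'a \<Rightarrow> real) \<Rightarrow> bool" where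
  "orthomartingale P F M \<longleftrightarrow>
     (\<forall>n. (\<exists>q. n $ q = 0) \<longrightarrow> (\<forall>\<omega>\<in>space P. M n \<omega> = 0)) \<and>
     (\<forall>n\<ge>1. M n \<in> borel_measurable (F n) \<and> integrable P (M n)) \<and>
     (\<forall>i j. i \<le> j \<longrightarrow> (AE \<omega> in P. real_cond_exp P (F i) (M j) \<omega> = M i \<omega>))"

text \<open>Values of \<open>D\<close> at indices outside $\mathbb{N}^d$ are unconstrained and never used.\<close>

definition orthomartingale_differences ::
    "'a measure \<Rightarrow> (nat ^ 'd::finite \<Rightarrow> 'a \<Rightarrow> real) \<Rightarrow> (nat ^ 'd \<Rightarrow> 'a \<Rightarrow> real) \<Rightarrow> bool" where
  "orthomartingale_differences P M D \<longleftrightarrow>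
     (\<forall>n\<ge>1. D n \<in> borel_measurable P) \<and>
     (\<forall>n\<ge>1. \<forall>\<omega>\<in>space P. M n \<omega> = (\<Sum>i\<in>{1..n}. D i \<omega>))"

text \<open>Equality of all finite-dimensional distributions under every shift of the index.\<close>

definition strictly_stationary ::
    "'a measure \<Rightarrow> (nat ^ 'd::finite \<Rightarrow> 'a \<Rightarrow> real) \<Rightarrow> bool" where
  "strictly_stationary P D \<longleftrightarrow>
     (\<forall>h I. finite I \<and> I \<subseteq> {1..} \<longrightarrow>
        distr P (\<Pi>\<^sub>M i\<in>I. borel) (\<lambda>\<omega>. \<lambda>i\<in>I. D (i + h) \<omega>)
      = distr P (\<Pi>\<^sub>M i\<in>I. borel) (\<lambda>\<omega>. \<lambda>i\<in>I. D i \<omega>))"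

end

theory Submission
  imports Defs
begin

text \<open>
  Off a bad event the increments over a mesh of size $\delta$ are controlled, one coordinate at a time, by
  the increments over about $1/\delta$ slabs of relative width $\delta$. So the maximum over one slab
  has to exceed $\epsilon |n|^{1/2}$ with probability $o(\delta)$, uniformly in $n$. Chebyshev's inequality
  with second moments only gives $O(\delta)$, so each difference is split as $D_i = D_i' + D_i''$: $D_i'$ is
  the truncation of $D_i$ projected back onto the orthomartingale differences, and $D_i''$ has small
  second moment by stationarity. For the bounded part fourth moments
  give $O(\delta^2)$; the remainder gives a small multiple of $\delta$. Maxima are reduced to the last value by
  Doob's $L^2$ inequality applied successively in every coordinate (Cairoli), and the moments of the
  last value are bounded by iterating a one-step martingale estimate.
\<close>

subsection \<open>Maximal inequalities\<close>

text \<open>Doob's inequality and the moment estimates are one-parameter statements, whereas the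
  filtration has d parameters. The bridge is the family \<open>F (idx_upd N q k)\<close>: inside the
  box below N the corner N stands for infinity, so that only coordinate q is restricted. Commutation
  turns the centering of \<open>D n\<close> given \<open>F (idx_upd n q (n $ q - 1))\<close> into
  centering with respect to this family, for every q. Truncation destroys the centering in all d
  directions, hence the projection. The projected field need not be stationary; all that is asked of
  it is a bound on its size and on its distance to D, uniformly in n. The gain from fourth moments
  rests on the square root of the fourth moment being subadditive, up to a factor, along martingale
  steps: a slab of at most 3 \<delta> |N| indices has fourth moment of order \<delta>^2 |N|^2,
  against the fourth power of the threshold, of order |N|^2. The truncation level K is fixed by the
  permitted second-moment error before \<delta> tends to 0, because K^4 multiplies the remaining
  power of \<delta>.\<close>

definition square_integrable :: "'a measure \<Rightarrow> ('a \<Rightarrow> real) \<Rightarrow> bool" where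
  "square_integrable P X \<longleftrightarrow> X \<in> borel_measurable P \<and> integrable P (\<lambda>\<omega>. (X \<omega>)\<^sup>2)"

lemma square_integrable_mult:
  assumes "square_integrable P X" "square_integrable P Y"
  shows "integrable P (\<lambda>\<omega>. X \<omega> * Y \<omega>)"
proof (rule Bochner_Integration.integrable_bound)
  show "integrable P (\<lambda>\<omega>. (X \<omega>)\<^sup>2 + (Y \<omega>)\<^sup>2)"
    using assms by (auto simp: square_integrable_def)
  show "(\<lambda>\<omega>. X \<omega> * Y \<omega>) \<in> borel_measurable P"
    using assms by (auto simp: square_integrable_def)
  have "\<bar>x * y\<bar> \<le> x\<^sup>2 + y\<^sup>2" for x y :: real
  proof -
    have "0 \<le> (\<bar>x\<bar> - \<bar>y\<bar>)\<^sup>2" "0 \<le> x\<^sup>2" "0 \<le> y\<^sup>2" by auto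
    then show ?thesis unfolding power2_diff abs_mult by (simp; linarith)
  qed
  then show "AE \<omega> in P. norm (X \<omega> * Y \<omega>) \<le> norm ((X \<omega>)\<^sup>2 + (Y \<omega>)\<^sup>2)"
    by (auto intro!: AE_I2)
qed

lemma square_integrable_integrable:
  assumes "prob_space P" "square_integrable P X"
  shows "integrable P X"
proof -
  interpret prob_space P by fact
  have "square_integrable P (\<lambda>_. 1)" by (auto simp: square_integrable_def)
  from square_integrable_mult[OF this assms(2)] show ?thesis by simp
qed

lemma square_integrable_add:
  assumes "square_integrable P X" "square_integrable P Y"
  shows "square_integrable P (\<lambda>\<omega>. X \<omega> + Y \<omega>)"
  using assms square_integrable_mult[OF assms]
  by (auto simp: square_integrable_def power2_sum mult.assoc)

lemma square_integrable_cmult: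
  assumes "square_integrable P X"
  shows "square_integrable P (\<lambda>\<omega>. c * X \<omega>)"
  using assms by (auto simp: square_integrable_def power_mult_distrib)

lemma square_integrable_diff:
  assumes "square_integrable P X" "square_integrable P Y"
  shows "square_integrable P (\<lambda>\<omega>. X \<omega> - Y \<omega>)"
  using square_integrable_add[OF assms(1) square_integrable_cmult[OF assms(2), of "-1"]] by simp

lemma square_integrable_sum:
  assumes "\<And>i. i \<in> I \<Longrightarrow> square_integrable P (X i)"
  shows "square_integrable P (\<lambda>\<omega>. \<Sum>i\<in>I. X i \<omega>)"
  using assms
proof (induction I rule: infinite_finite_induct)
  case (insert i I)
  then show ?case using square_integrable_add[of P "X i" "\<lambda>\<omega>. \<Sum>i\<in>I. X i \<omega>"] by simp
qed (auto simp: square_integrable_def)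

lemma square_integrable_bound:
  assumes "square_integrable P Y" "X \<in> borel_measurable P"
    and "\<And>\<omega>. \<omega> \<in> space P \<Longrightarrow> \<bar>X \<omega>\<bar> \<le> \<bar>Y \<omega>\<bar>"
  shows "square_integrable P X"
  unfolding square_integrable_def
proof
  show "integrable P (\<lambda>\<omega>. (X \<omega>)\<^sup>2)"
    by (rule Bochner_Integration.integrable_bound[of _ "\<lambda>\<omega>. (Y \<omega>)\<^sup>2"])
      (use assms in \<open>auto simp: square_integrable_def abs_le_square_iff[symmetric]\<close>)
qed fact

lemma square_integrable_max:
  assumes "square_integrable P X" "square_integrable P Y"
  shows "square_integrable P (\<lambda>\<omega>. max (X \<omega>) (Y \<omega>))"
proof (rule square_integrable_bound)
  have *: "square_integrable P Z \<Longrightarrow> square_integrable P (\<lambda>\<omega>. \<bar>Z \<omega>\<bar>)" for Z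
    by (auto simp: square_integrable_def)
  show "square_integrable P (\<lambda>\<omega>. \<bar>X \<omega>\<bar> + \<bar>Y \<omega>\<bar>)"
    by (intro square_integrable_add * assms)
qed (use assms in \<open>auto simp: square_integrable_def\<close>)

lemma square_integrable_Max:
  assumes "finite J" "J \<noteq> {}" "\<And>j. j \<in> J \<Longrightarrow> square_integrable P (X j)"
  shows "square_integrable P (\<lambda>\<omega>. Max ((\<lambda>j. X j \<omega>) ` J))"
  using assms
proof (induction J rule: finite_ne_induct)
  case (insert i I)
  then show ?case using square_integrable_max[of P "X i" "\<lambda>\<omega>. Max ((\<lambda>j. X j \<omega>) ` I)"] by simp
qed simp

section \<open>Submartingale steps and Doob's inequality in L2\<close>

lemma prob_space_subalgebra:
  assumes "prob_space P" "subalgebra P G"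
  shows "finite_measure_subalgebra P G"
  using assms
  by (simp add: finite_measure_subalgebra_def finite_measure_subalgebra_axioms_def prob_space.finite_measure)

text \<open>A single step rather than a process: in Cairoli's argument the steps run in different
  coordinates, each with its own filtration.\<close>

definition submartingale_step ::
    "'a measure \<Rightarrow> 'a measure \<Rightarrow> ('a \<Rightarrow> real) \<Rightarrow> ('a \<Rightarrow> real) \<Rightarrow> bool" where
  "submartingale_step P G X Y \<longleftrightarrow> integrable P X \<and> integrable P Y \<and> X \<in> borel_measurable G \<and>
     (AE \<omega> in P. X \<omega> \<le> real_cond_exp P G Y \<omega>)"

lemma submartingale_step_max:
  assumes "prob_space P" "subalgebra P G"
    and "submartingale_step P G X Y" "submartingale_step P G X' Y'"
  shows "submartingale_step P G (\<lambda>\<omega>. max (X \<omega>) (X' \<omega>)) (\<lambda>\<omega>. max (Y \<omega>) (Y' \<omega>))"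
proof -
  interpret finite_measure_subalgebra P G
    using assms(1,2) by (rule prob_space_subalgebra)
  have i: "integrable P X" "integrable P Y" "integrable P X'" "integrable P Y'"
    and m: "X \<in> borel_measurable G" "X' \<in> borel_measurable G"
    using assms(3,4) by (auto simp: submartingale_step_def)
  have "AE \<omega> in P. real_cond_exp P G Y \<omega> \<le> real_cond_exp P G (\<lambda>\<omega>. max (Y \<omega>) (Y' \<omega>)) \<omega>"
    by (rule real_cond_exp_mono) (use i in auto)
  moreover have "AE \<omega> in P. real_cond_exp P G Y' \<omega> \<le> real_cond_exp P G (\<lambda>\<omega>. max (Y \<omega>) (Y' \<omega>)) \<omega>"
    by (rule real_cond_exp_mono) (use i in auto)
  moreover have "AE \<omega> in P. X \<omega> \<le> real_cond_exp P G Y \<omega>" "AE \<omega> in P. X' \<omega> \<le> real_cond_exp P G Y' \<omega>"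
    using assms(3,4) by (auto simp: submartingale_step_def)
  ultimately have "AE \<omega> in P. max (X \<omega>) (X' \<omega>) \<le> real_cond_exp P G (\<lambda>\<omega>. max (Y \<omega>) (Y' \<omega>)) \<omega>"
    by eventually_elim auto
  then show ?thesis using i m by (auto simp: submartingale_step_def)
qed

text \<open>Partial maxima over the coordinates already treated thus stay submartingales in the next
  coordinate, which is what allows Doob's inequality to be iterated.\<close>

lemma submartingale_step_Max:
  assumes "prob_space P" "subalgebra P G" "finite J" "J \<noteq> {}"
    and "\<And>j. j \<in> J \<Longrightarrow> submartingale_step P G (X j) (Y j)"
  shows "submartingale_step P G (\<lambda>\<omega>. Max ((\<lambda>j. X j \<omega>) ` J)) (\<lambda>\<omega>. Max ((\<lambda>j. Y j \<omega>) ` J))"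
  using assms(3-5)
proof (induction J rule: finite_ne_induct)
  case (insert i I)
  then have "submartingale_step P G (X i) (Y i)"
    "submartingale_step P G (\<lambda>\<omega>. Max ((\<lambda>j. X j \<omega>) ` I)) (\<lambda>\<omega>. Max ((\<lambda>j. Y j \<omega>) ` I))" by auto
  from submartingale_step_max[OF assms(1,2) this] show ?case
    using insert by simp
qed simp

lemma submartingale_step_integral:
  assumes "prob_space P" "subalgebra P G" "submartingale_step P G X Y"
    and "Z \<in> borel_measurable G" "\<And>\<omega>. \<omega> \<in> space P \<Longrightarrow> 0 \<le> Z \<omega>"
    and "integrable P (\<lambda>\<omega>. Z \<omega> * X \<omega>)" "integrable P (\<lambda>\<omega>. Z \<omega> * Y \<omega>)"
  shows "(\<integral>\<omega>. Z \<omega> * X \<omega> \<partial>P) \<le> (\<integral>\<omega>. Z \<omega> * Y \<omega> \<partial>P)"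
proof -
  interpret finite_measure_subalgebra P G
    using assms(1,2) by (rule prob_space_subalgebra)
  have Y: "Y \<in> borel_measurable P" and le: "AE \<omega> in P. X \<omega> \<le> real_cond_exp P G Y \<omega>"
    using assms(3) by (auto simp: submartingale_step_def)
  note c = real_cond_exp_intg[OF assms(7,4) Y]
  have "(\<integral>\<omega>. Z \<omega> * X \<omega> \<partial>P) \<le> (\<integral>\<omega>. Z \<omega> * real_cond_exp P G Y \<omega> \<partial>P)"
  proof (rule integral_mono_AE)
    show "AE \<omega> in P. Z \<omega> * X \<omega> \<le> Z \<omega> * real_cond_exp P G Y \<omega>"
      using le AE_space by eventually_elim (auto intro!: mult_left_mono assms(5))
  qed (use c assms in auto)
  then show ?thesis using c by simp
qed

lemma Max_image_atMost_Suc: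
  "Max (f ` {..Suc n}) = max (f (Suc n)) (Max (f ` {..n}))" for f :: "nat \<Rightarrow> real"
  by (simp add: atMost_Suc)

text \<open>Doob's inequality before integration: the sum is a discrete stochastic integral of the
  running maximum, and its expectation is nonnegative for a nonnegative submartingale. The constant
  4 of the L2 inequality is visible here without stopping times.\<close>

lemma doob_pathwise:
  fixes s :: "nat \<Rightarrow> real"
  assumes "\<And>k. k \<le> n \<Longrightarrow> 0 \<le> s k"
  shows "(Max (s ` {..n}))\<^sup>2 \<le> 4 * (s n)\<^sup>2 - 4 * (\<Sum>k<n. Max (s ` {..k}) * (s (Suc k) - s k))"
proof -
  define b where "b k = Max (s ` {..k})" for k
  \<comment> \<open>a discrete integration by parts; it is an equality while the running maximum does not grow\<close>
  have "(\<Sum>k<n. b k * (s (Suc k) - s k)) \<le> b n * s n - (b n)\<^sup>2 / 2"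
  proof (induction n)
    case 0
    then show ?case by (simp add: b_def power2_eq_square)
  next
    case (Suc n)
    have "b n * (s (Suc n) - s n) \<le> (b (Suc n) * s (Suc n) - (b (Suc n))\<^sup>2 / 2) - (b n * s n - (b n)\<^sup>2 / 2)"
    proof (cases "s (Suc n) \<le> b n")
      case True
      then have "b (Suc n) = b n" by (simp add: b_def Max_image_atMost_Suc)
      then show ?thesis by (simp add: algebra_simps)
    next
      case False
      then have *: "b (Suc n) = s (Suc n)" by (simp add: b_def Max_image_atMost_Suc)
      have "0 \<le> (s (Suc n) - b n)\<^sup>2" by simp
      then show ?thesis unfolding * by (simp add: power2_eq_square algebra_simps)
    qed
    then show ?case using Suc by simp
  qed
  \<comment> \<open>By the bound just proved, the right-hand side of the claim is at least 4 s^2 - 4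
    b s + 2 b^2, which exceeds b^2 by exactly this square.\<close>
  moreover have "0 \<le> (2 * s n - b n)\<^sup>2" by simp
  ultimately have "(b n)\<^sup>2 \<le> 4 * (s n)\<^sup>2 - 4 * (\<Sum>k<n. b k * (s (Suc k) - s k))"
    by (simp add: power2_eq_square algebra_simps; linarith)
  then show ?thesis unfolding b_def .
qed

lemma doob_L2:
  assumes P: "prob_space P" and G: "\<And>k. subalgebra P (G k)"
    and mono: "\<And>i k. i \<le> k \<Longrightarrow> sets (G i) \<subseteq> sets (G k)"
    and s0: "\<And>k \<omega>. k \<le> n \<Longrightarrow> \<omega> \<in> space P \<Longrightarrow> 0 \<le> s k \<omega>"
    and s2: "\<And>k. k \<le> n \<Longrightarrow> square_integrable P (s k)"
    and sub: "\<And>k. k < n \<Longrightarrow> submartingale_step P (G k) (s k) (s (Suc k))"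
  shows "(\<integral>\<omega>. (Max ((\<lambda>k. s k \<omega>) ` {..n}))\<^sup>2 \<partial>P) \<le> 4 * (\<integral>\<omega>. (s n \<omega>)\<^sup>2 \<partial>P)"
proof -
  define b where "b k \<omega> = Max ((\<lambda>k. s k \<omega>) ` {..k})" for k \<omega>
  have b2: "square_integrable P (b k)" if "k \<le> n" for k
    unfolding b_def using that by (intro square_integrable_Max s2) auto
  have i: "integrable P (\<lambda>\<omega>. b k \<omega> * s (Suc k) \<omega>)" "integrable P (\<lambda>\<omega>. b k \<omega> * s k \<omega>)" if "k < n" for k
    using that by (auto intro!: square_integrable_mult b2 s2)
  \<comment> \<open>The running maximum \<open>b k\<close> is nonnegative and known at time k, so it
    is an admissible integrand for the step from k to \<open>Suc k\<close>.\<close>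
  have "(\<integral>\<omega>. b k \<omega> * s k \<omega> \<partial>P) \<le> (\<integral>\<omega>. b k \<omega> * s (Suc k) \<omega> \<partial>P)" if "k < n" for k
  proof (rule submartingale_step_integral[OF P G[of k] sub[OF that] _ _ i(2,1)[OF that]])
    have "s i \<in> borel_measurable (G k)" if "i \<le> k" for i
    proof (rule measurable_from_subalg)
      show "s i \<in> borel_measurable (G i)"
        using sub[of i] \<open>i \<le> k\<close> \<open>k < n\<close> by (auto simp: submartingale_step_def)
      show "subalgebra (G k) (G i)"
        using G[of k] G[of i] mono[OF \<open>i \<le> k\<close>] by (auto simp: subalgebra_def)
    qed
    then show "b k \<in> borel_measurable (G k)"
      unfolding b_def by (intro borel_measurable_Max) auto
    fix \<omega> assume "\<omega> \<in> space P"
    then have "0 \<le> s k \<omega>" using \<open>k < n\<close> s0 by auto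
    also have "\<dots> \<le> b k \<omega>" unfolding b_def by (intro Max_ge) auto
    finally show "0 \<le> b k \<omega>" .
  qed
  then have "0 \<le> (\<Sum>k<n. (\<integral>\<omega>. b k \<omega> * s (Suc k) \<omega> \<partial>P) - (\<integral>\<omega>. b k \<omega> * s k \<omega> \<partial>P))"
    by (intro sum_nonneg) auto
  also have "\<dots> = (\<integral>\<omega>. (\<Sum>k<n. b k \<omega> * (s (Suc k) \<omega> - s k \<omega>)) \<partial>P)"
    by (subst Bochner_Integration.integral_sum)
      (use i in \<open>auto simp: right_diff_distrib intro!: sum.cong\<close>)
  finally have pos: "0 \<le> (\<integral>\<omega>. (\<Sum>k<n. b k \<omega> * (s (Suc k) \<omega> - s k \<omega>)) \<partial>P)" .
  have int: "integrable P (\<lambda>\<omega>. \<Sum>k<n. b k \<omega> * (s (Suc k) \<omega> - s k \<omega>))"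
    using i by (auto simp: right_diff_distrib)
  have sn: "integrable P (\<lambda>\<omega>. (s n \<omega>)\<^sup>2)" using s2[of n] by (auto simp: square_integrable_def)
  have "(\<integral>\<omega>. (b n \<omega>)\<^sup>2 \<partial>P) \<le> (\<integral>\<omega>. 4 * (s n \<omega>)\<^sup>2 - 4 * (\<Sum>k<n. b k \<omega> * (s (Suc k) \<omega> - s k \<omega>)) \<partial>P)"
    unfolding b_def
    by (rule integral_mono)
     (use b2[of n] sn int s0 in \<open>auto simp: square_integrable_def b_def intro!: doob_pathwise\<close>)
  also have "\<dots> = 4 * (\<integral>\<omega>. (s n \<omega>)\<^sup>2 \<partial>P) - 4 * (\<integral>\<omega>. (\<Sum>k<n. b k \<omega> * (s (Suc k) \<omega> - s k \<omega>)) \<partial>P)"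
    using sn int by (subst Bochner_Integration.integral_diff) auto
  finally show ?thesis using pos unfolding b_def by simp
qed

section \<open>From one parameter to d parameters: Cairoli's inequality\<close>

definition idx_upd :: "nat ^ 'd \<Rightarrow> 'd \<Rightarrow> nat \<Rightarrow> nat ^ 'd" where
  "idx_upd a q k = (\<chi> r. if r = q then k else a $ r)"

lemma idx_upd_nth [simp]: "idx_upd a q k $ r = (if r = q then k else a $ r)"
  by (simp add: idx_upd_def)

lemma idx_upd_triv [simp]: "idx_upd a q (a $ q) = a"
  by (simp add: vec_eq_iff)

lemma idx_upd_upd [simp]: "idx_upd (idx_upd a q k) q l = idx_upd a q l"
  by (simp add: vec_eq_iff)

lemma finite_idx_atMost [simp]: "finite {..n :: nat ^ 'd::finite}"
proof -
  have "{..n} \<subseteq> vec_lambda ` (PiE UNIV (\<lambda>q. {..n $ q}))"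
  proof
    fix a assume "a \<in> {..n}"
    then have "a = vec_lambda (\<lambda>q. a $ q)" "(\<lambda>q. a $ q) \<in> PiE UNIV (\<lambda>q. {..n $ q})"
      by (auto simp: vec_eq_iff less_eq_vec_def)
    then show "a \<in> vec_lambda ` (PiE UNIV (\<lambda>q. {..n $ q}))" by blast
  qed
  then show ?thesis by (rule finite_subset) (auto intro!: finite_imageI finite_PiE)
qed

lemma finite_idx_atLeastAtMost [simp]: "finite {m..n :: nat ^ 'd::finite}"
  by (rule finite_subset[OF _ finite_idx_atMost[of n]]) auto

text \<open>Doob's inequality is used once per coordinate, each time at the cost of a factor 4; the
  submartingale in the new coordinate is the maximum over all coordinates used before.\<close>

lemma cairoli_L2:
  fixes V :: "nat ^ 'd::finite \<Rightarrow> 'a \<Rightarrow> real" and G :: "'d \<Rightarrow> nat \<Rightarrow> 'a measure"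
  assumes P: "prob_space P" and G: "\<And>q k. subalgebra P (G q k)"
    and mono: "\<And>q i k. i \<le> k \<Longrightarrow> sets (G q i) \<subseteq> sets (G q k)"
    and V0: "\<And>a \<omega>. a \<le> N \<Longrightarrow> \<omega> \<in> space P \<Longrightarrow> 0 \<le> V a \<omega>"
    and V2: "\<And>a. a \<le> N \<Longrightarrow> square_integrable P (V a)"
    and sub: "\<And>a q k. a \<le> N \<Longrightarrow> k < N $ q \<Longrightarrow>
      submartingale_step P (G q k) (V (idx_upd a q k)) (V (idx_upd a q (Suc k)))"
  shows "(\<integral>\<omega>. (Max ((\<lambda>a. V a \<omega>) ` {..N}))\<^sup>2 \<partial>P) \<le> 4 ^ CARD('d) * (\<integral>\<omega>. (V N \<omega>)\<^sup>2 \<partial>P)"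
proof -
  \<comment> \<open>The face of the box on which the coordinates outside Q are frozen at their last
    value. It grows from the corner N to the whole box.\<close>
  define I where "I Q = {a. a \<le> N \<and> (\<forall>r. r \<notin> Q \<longrightarrow> a $ r = N $ r)}" for Q
  have fin: "finite (I Q)" for Q
    by (rule finite_subset[OF _ finite_idx_atMost[of N]]) (auto simp: I_def)
  have ne: "N \<in> I Q" for Q by (auto simp: I_def)
  have upd: "idx_upd a q k \<le> N" if "a \<le> N" "k \<le> N $ q" for a q k
    using that by (auto simp: less_eq_vec_def)
  have "(\<integral>\<omega>. (Max ((\<lambda>a. V a \<omega>) ` I Q))\<^sup>2 \<partial>P) \<le> 4 ^ card Q * (\<integral>\<omega>. (V N \<omega>)\<^sup>2 \<partial>P)" if "finite Q" for Q
    using that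
  proof (induction Q rule: finite_induct)
    case empty
    have "I {} = {N}" by (auto simp: I_def vec_eq_iff)
    then show ?case by simp
  next
    case (insert q Q)
    define s where "s k \<omega> = Max ((\<lambda>a. V (idx_upd a q k) \<omega>) ` I Q)" for k \<omega>
    have IQ: "I (insert q Q) = (\<Union>k\<le>N $ q. (\<lambda>a. idx_upd a q k) ` I Q)"
    proof (intro equalityI subsetI)
      fix a assume a: "a \<in> I (insert q Q)"
      have "idx_upd a q (N $ q) \<in> I Q"
        using a insert by (auto simp: I_def less_eq_vec_def)
      moreover have "a = idx_upd (idx_upd a q (N $ q)) q (a $ q)" by simp
      moreover have "a $ q \<le> N $ q" using a by (auto simp: I_def less_eq_vec_def)
      ultimately show "a \<in> (\<Union>k\<le>N $ q. (\<lambda>a. idx_upd a q k) ` I Q)" by blast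
    qed (auto simp: I_def less_eq_vec_def)
    have "Max ((\<lambda>a. V a \<omega>) ` I (insert q Q)) \<le> Max ((\<lambda>k. s k \<omega>) ` {..N $ q})" for \<omega>
    proof (rule Max.boundedI)
      fix x assume "x \<in> (\<lambda>a. V a \<omega>) ` I (insert q Q)"
      then obtain a k where ak: "k \<le> N $ q" "a \<in> I Q" "x = V (idx_upd a q k) \<omega>"
        unfolding IQ by auto
      then have "x \<le> s k \<omega>" unfolding s_def using fin by (auto intro!: Max_ge)
      also have "\<dots> \<le> Max ((\<lambda>k. s k \<omega>) ` {..N $ q})" using ak by (auto intro!: Max_ge)
      finally show "x \<le> Max ((\<lambda>k. s k \<omega>) ` {..N $ q})" .
    qed (use fin ne in auto)
    moreover have "0 \<le> Max ((\<lambda>a. V a \<omega>) ` I (insert q Q))" if "\<omega> \<in> space P" for \<omega>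
      by (rule order_trans[OF V0[of N, OF _ that]]) (use fin ne in \<open>auto intro!: Max_ge\<close>)
    moreover have s2: "square_integrable P (s k)" if "k \<le> N $ q" for k
      unfolding s_def
      by (intro square_integrable_Max fin V2 upd) (use that ne in \<open>auto simp: I_def\<close>)
    moreover have "square_integrable P (\<lambda>\<omega>. Max ((\<lambda>k. s k \<omega>) ` {..N $ q}))"
      by (intro square_integrable_Max s2) auto
    moreover have "square_integrable P (\<lambda>\<omega>. Max ((\<lambda>a. V a \<omega>) ` I (insert q Q)))"
      by (intro square_integrable_Max fin V2) (use ne in \<open>auto simp: I_def\<close>)
    ultimately have "(\<integral>\<omega>. (Max ((\<lambda>a. V a \<omega>) ` I (insert q Q)))\<^sup>2 \<partial>P) \<le> (\<integral>\<omega>. (Max ((\<lambda>k. s k \<omega>) ` {..N $ q}))\<^sup>2 \<partial>P)"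
      by (intro integral_mono) (auto simp: square_integrable_def intro!: power_mono)
    also have "\<dots> \<le> 4 * (\<integral>\<omega>. (s (N $ q) \<omega>)\<^sup>2 \<partial>P)"
    proof (rule doob_L2[OF P G mono])
      fix k \<omega> assume k: "k \<le> N $ q" "\<omega> \<in> space P"
      have "0 \<le> V (idx_upd N q k) \<omega>" using k by (intro V0 upd) auto
      also have "\<dots> \<le> s k \<omega>" unfolding s_def using fin ne by (intro Max_ge) auto
      finally show "0 \<le> s k \<omega>" .
    next
      fix k assume k: "k < N $ q"
      then show "submartingale_step P (G q k) (s k) (s (Suc k))"
        unfolding s_def using fin ne
        by (intro submartingale_step_Max[OF P G] sub) (auto simp: I_def)
    qed (use s2 in auto)
    \<comment> \<open>Since q is not in Q, the points of \<open>I Q\<close> already have q-th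
      coordinate \<open>N $ q\<close>, so the terminal value of s is the maximum of the induction
      hypothesis.\<close>
    also have "s (N $ q) = (\<lambda>\<omega>. Max ((\<lambda>a. V a \<omega>) ` I Q))"
    proof -
      have "idx_upd a q (N $ q) = a" if "a \<in> I Q" for a
        using that insert by (auto simp: vec_eq_iff I_def)
      then show ?thesis unfolding s_def by (simp cong: image_cong)
    qed
    also have "4 * (\<integral>\<omega>. (Max ((\<lambda>a. V a \<omega>) ` I Q))\<^sup>2 \<partial>P) \<le> 4 * (4 ^ card Q * (\<integral>\<omega>. (V N \<omega>)\<^sup>2 \<partial>P))"
      using insert by auto
    finally show ?case using insert by simp
  qed
  from this[of UNIV] show ?thesis by (simp add: I_def atMost_def)
qed

section \<open>Conditionally centered variables\<close>

definition centered :: "'a measure \<Rightarrow> 'a measure \<Rightarrow> ('a \<Rightarrow> real) \<Rightarrow> bool" where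
  "centered P G X \<longleftrightarrow> integrable P X \<and> (AE \<omega> in P. real_cond_exp P G X \<omega> = 0)"

lemma centered_add:
  assumes "prob_space P" "subalgebra P G" "centered P G X" "centered P G Y"
  shows "centered P G (\<lambda>\<omega>. X \<omega> + Y \<omega>)"
proof -
  interpret finite_measure_subalgebra P G
    using assms(1,2) by (rule prob_space_subalgebra)
  have "AE \<omega> in P. real_cond_exp P G (\<lambda>\<omega>. X \<omega> + Y \<omega>) \<omega> = real_cond_exp P G X \<omega> + real_cond_exp P G Y \<omega>"
    using assms by (intro real_cond_exp_add) (auto simp: centered_def)
  moreover have "AE \<omega> in P. real_cond_exp P G X \<omega> = 0" "AE \<omega> in P. real_cond_exp P G Y \<omega> = 0"
    using assms by (auto simp: centered_def)
  ultimately have "AE \<omega> in P. real_cond_exp P G (\<lambda>\<omega>. X \<omega> + Y \<omega>) \<omega> = 0"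
    by eventually_elim auto
  then show ?thesis using assms by (auto simp: centered_def)
qed

lemma centered_zero:
  assumes "prob_space P" "subalgebra P G"
  shows "centered P G (\<lambda>_. 0)"
proof -
  interpret finite_measure_subalgebra P G
    using assms(1,2) by (rule prob_space_subalgebra)
  have "AE \<omega> in P. real_cond_exp P G (\<lambda>_. 0) \<omega> = 0"
    by (rule real_cond_exp_F_meas) auto
  then show ?thesis by (auto simp: centered_def)
qed

lemma centered_sum:
  assumes "prob_space P" "subalgebra P G" "\<And>i. i \<in> I \<Longrightarrow> centered P G (X i)"
  shows "centered P G (\<lambda>\<omega>. \<Sum>i\<in>I. X i \<omega>)"
  using assms(3)
proof (induction I rule: infinite_finite_induct)
  case (insert i I)
  then show ?case
    using centered_add[OF assms(1,2), of "X i" "\<lambda>\<omega>. \<Sum>i\<in>I. X i \<omega>"] by simp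
qed (simp_all add: centered_zero[OF assms(1,2)])

lemma centered_uminus:
  assumes "prob_space P" "subalgebra P G" "centered P G X"
  shows "centered P G (\<lambda>\<omega>. - X \<omega>)"
proof -
  interpret finite_measure_subalgebra P G
    using assms(1,2) by (rule prob_space_subalgebra)
  have "AE \<omega> in P. real_cond_exp P G (\<lambda>\<omega>. - 1 * X \<omega>) \<omega> = - 1 * real_cond_exp P G X \<omega>"
    using assms by (intro real_cond_exp_cmult) (auto simp: centered_def)
  moreover have "AE \<omega> in P. real_cond_exp P G X \<omega> = 0"
    using assms by (auto simp: centered_def)
  ultimately have "AE \<omega> in P. real_cond_exp P G (\<lambda>\<omega>. - 1 * X \<omega>) \<omega> = 0"
    by eventually_elim auto
  then show ?thesis using assms by (auto simp: centered_def)
qed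

lemma centered_diff:
  assumes "prob_space P" "subalgebra P G" "centered P G X" "centered P G Y"
  shows "centered P G (\<lambda>\<omega>. X \<omega> - Y \<omega>)"
  using centered_add[OF assms(1-3) centered_uminus[OF assms(1,2,4)]] by simp

lemma centered_cong:
  assumes "prob_space P" "subalgebra P G" "centered P G X"
    and "AE \<omega> in P. X \<omega> = Y \<omega>" "Y \<in> borel_measurable P"
  shows "centered P G Y"
proof -
  interpret finite_measure_subalgebra P G
    using assms(1,2) by (rule prob_space_subalgebra)
  have X: "integrable P X" "AE \<omega> in P. real_cond_exp P G X \<omega> = 0"
    using assms(3) by (auto simp: centered_def)
  have "integrable P Y"
    by (rule integrable_cong_AE_imp[OF X(1) assms(5,4)])
  moreover have "AE \<omega> in P. real_cond_exp P G X \<omega> = real_cond_exp P G Y \<omega>"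
    using X(1) assms(4,5) by (intro real_cond_exp_cong) auto
  with X(2) have "AE \<omega> in P. real_cond_exp P G Y \<omega> = 0"
    by eventually_elim auto
  ultimately show ?thesis by (simp add: centered_def)
qed

text \<open>Source of all cancellations: it removes the mixed term S D from the second moment and
  the cubic term S^3 D from the fourth.\<close>

lemma centered_integral:
  assumes "prob_space P" "subalgebra P G" "centered P G X"
    and "Z \<in> borel_measurable G" "integrable P (\<lambda>\<omega>. Z \<omega> * X \<omega>)"
  shows "(\<integral>\<omega>. Z \<omega> * X \<omega> \<partial>P) = 0"
proof -
  interpret finite_measure_subalgebra P G
    using assms(1,2) by (rule prob_space_subalgebra)
  have "(\<integral>\<omega>. Z \<omega> * X \<omega> \<partial>P) = (\<integral>\<omega>. Z \<omega> * real_cond_exp P G X \<omega> \<partial>P)"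
    using assms by (intro real_cond_exp_intg(2)[symmetric]) (auto simp: centered_def)
  also have "\<dots> = (\<integral>\<omega>. 0 \<partial>P)"
  proof (rule integral_cong_AE)
    have "AE \<omega> in P. real_cond_exp P G X \<omega> = 0" using assms by (auto simp: centered_def)
    then show "AE \<omega> in P. Z \<omega> * real_cond_exp P G X \<omega> = 0" by eventually_elim simp
    show "(\<lambda>\<omega>. Z \<omega> * real_cond_exp P G X \<omega>) \<in> borel_measurable P"
      using measurable_from_subalg[OF assms(2,4)] by simp
  qed simp
  finally show ?thesis by simp
qed

text \<open>Conditional Jensen by hand: the conditional expectation of |S + D| dominates those of S
  + D and of -(S + D), which are S and -S.\<close>

lemma submartingale_step_abs:
  assumes "prob_space P" "subalgebra P G" "integrable P S" "S \<in> borel_measurable G" "centered P G D"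
  shows "submartingale_step P G (\<lambda>\<omega>. \<bar>S \<omega>\<bar>) (\<lambda>\<omega>. \<bar>S \<omega> + D \<omega>\<bar>)"
proof -
  interpret finite_measure_subalgebra P G
    using assms(1,2) by (rule prob_space_subalgebra)
  have D: "integrable P D" "AE \<omega> in P. real_cond_exp P G D \<omega> = 0"
    using assms(5) by (auto simp: centered_def)
  have SD: "integrable P (\<lambda>\<omega>. S \<omega> + D \<omega>)" using assms D by auto
  have "AE \<omega> in P. real_cond_exp P G (\<lambda>\<omega>. S \<omega> + D \<omega>) \<omega> = real_cond_exp P G S \<omega> + real_cond_exp P G D \<omega>"
    by (rule real_cond_exp_add[OF assms(3) D(1)])
  moreover have "AE \<omega> in P. real_cond_exp P G S \<omega> = S \<omega>"
    using assms by (intro real_cond_exp_F_meas) auto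
  moreover have "AE \<omega> in P. real_cond_exp P G (\<lambda>\<omega>. S \<omega> + D \<omega>) \<omega> \<le> real_cond_exp P G (\<lambda>\<omega>. \<bar>S \<omega> + D \<omega>\<bar>) \<omega>"
    by (rule real_cond_exp_mono) (use SD in auto)
  moreover have "AE \<omega> in P. real_cond_exp P G (\<lambda>\<omega>. - 1 * (S \<omega> + D \<omega>)) \<omega> \<le> real_cond_exp P G (\<lambda>\<omega>. \<bar>S \<omega> + D \<omega>\<bar>) \<omega>"
    by (rule real_cond_exp_mono[OF AE_I2 integrable_mult_right[OF SD] integrable_abs[OF SD]]) (simp add: abs_if)
  moreover have "AE \<omega> in P. real_cond_exp P G (\<lambda>\<omega>. - 1 * (S \<omega> + D \<omega>)) \<omega> = - 1 * real_cond_exp P G (\<lambda>\<omega>. S \<omega> + D \<omega>) \<omega>"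
    by (rule real_cond_exp_cmult[OF SD])
  ultimately have "AE \<omega> in P. \<bar>S \<omega>\<bar> \<le> real_cond_exp P G (\<lambda>\<omega>. \<bar>S \<omega> + D \<omega>\<bar>) \<omega>"
    using D(2) by eventually_elim auto
  then show ?thesis using assms SD by (auto simp: submartingale_step_def)
qed

text \<open>Dropping D^2 from the expanded square leaves S^2 + 2 S D, whose conditional expectation
  is S^2.\<close>

lemma submartingale_step_square:
  assumes "prob_space P" "subalgebra P G" "square_integrable P S" "square_integrable P D"
    and "S \<in> borel_measurable G" "centered P G D"
  shows "submartingale_step P G (\<lambda>\<omega>. (S \<omega>)\<^sup>2) (\<lambda>\<omega>. (S \<omega> + D \<omega>)\<^sup>2)"
proof -
  interpret finite_measure_subalgebra P G
    using assms(1,2) by (rule prob_space_subalgebra)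
  have D: "integrable P D" "AE \<omega> in P. real_cond_exp P G D \<omega> = 0"
    using assms(6) by (auto simp: centered_def)
  have i: "integrable P (\<lambda>\<omega>. (S \<omega>)\<^sup>2)" "integrable P (\<lambda>\<omega>. (S \<omega> + D \<omega>)\<^sup>2)"
    "integrable P (\<lambda>\<omega>. S \<omega> * D \<omega>)"
    using assms(3) square_integrable_add[OF assms(3,4)] square_integrable_mult[OF assms(3,4)]
    by (auto simp: square_integrable_def)
  then have i2: "integrable P (\<lambda>\<omega>. (2 * S \<omega>) * D \<omega>)" by (simp add: mult.assoc)
  have "AE \<omega> in P. real_cond_exp P G (\<lambda>\<omega>. (S \<omega>)\<^sup>2 + (2 * S \<omega>) * D \<omega>) \<omega>
      = real_cond_exp P G (\<lambda>\<omega>. (S \<omega>)\<^sup>2) \<omega> + real_cond_exp P G (\<lambda>\<omega>. (2 * S \<omega>) * D \<omega>) \<omega>"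
    by (rule real_cond_exp_add[OF i(1) i2])
  moreover have "AE \<omega> in P. real_cond_exp P G (\<lambda>\<omega>. (S \<omega>)\<^sup>2) \<omega> = (S \<omega>)\<^sup>2"
    using assms i by (intro real_cond_exp_F_meas) auto
  moreover have "AE \<omega> in P. real_cond_exp P G (\<lambda>\<omega>. (2 * S \<omega>) * D \<omega>) \<omega> = 2 * S \<omega> * real_cond_exp P G D \<omega>"
    using assms D i2 by (intro real_cond_exp_mult) auto
  moreover have "AE \<omega> in P. real_cond_exp P G (\<lambda>\<omega>. (S \<omega>)\<^sup>2 + (2 * S \<omega>) * D \<omega>) \<omega> \<le> real_cond_exp P G (\<lambda>\<omega>. (S \<omega> + D \<omega>)\<^sup>2) \<omega>"
    by (rule real_cond_exp_mono[OF _ Bochner_Integration.integrable_add[OF i(1) i2] i(2)]) (simp add: power2_sum)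
  ultimately have "AE \<omega> in P. (S \<omega>)\<^sup>2 \<le> real_cond_exp P G (\<lambda>\<omega>. (S \<omega> + D \<omega>)\<^sup>2) \<omega>"
    using D(2) by eventually_elim auto
  then show ?thesis using assms i by (auto simp: submartingale_step_def)
qed

subsection \<open>Moment bounds for one martingale step\<close>

lemma second_moment_step:
  assumes "prob_space P" "subalgebra P G" "square_integrable P S" "square_integrable P D"
    and "S \<in> borel_measurable G" "centered P G D"
  shows "(\<integral>\<omega>. (S \<omega> + D \<omega>)\<^sup>2 \<partial>P) = (\<integral>\<omega>. (S \<omega>)\<^sup>2 \<partial>P) + (\<integral>\<omega>. (D \<omega>)\<^sup>2 \<partial>P)"
proof -
  note i = square_integrable_mult[OF assms(3,4)]
  have "(\<integral>\<omega>. S \<omega> * D \<omega> \<partial>P) = 0"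
    by (rule centered_integral[OF assms(1,2,6,5) i])
  moreover have "(\<integral>\<omega>. (S \<omega> + D \<omega>)\<^sup>2 \<partial>P) = (\<integral>\<omega>. (S \<omega>)\<^sup>2 + (D \<omega>)\<^sup>2 + 2 * (S \<omega> * D \<omega>) \<partial>P)"
    by (simp add: power2_sum mult.assoc)
  moreover have "\<dots> = (\<integral>\<omega>. (S \<omega>)\<^sup>2 \<partial>P) + (\<integral>\<omega>. (D \<omega>)\<^sup>2 \<partial>P) + 2 * (\<integral>\<omega>. S \<omega> * D \<omega> \<partial>P)"
    using i assms(3,4) by (simp add: square_integrable_def)
  ultimately show ?thesis by simp
qed

lemma Cauchy_Schwarz_integral:
  assumes "square_integrable P X" "square_integrable P Y"
  shows "(\<integral>\<omega>. X \<omega> * Y \<omega> \<partial>P) \<le> sqrt (\<integral>\<omega>. (X \<omega>)\<^sup>2 \<partial>P) * sqrt (\<integral>\<omega>. (Y \<omega>)\<^sup>2 \<partial>P)"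
proof -
  define a b c where "a = (\<integral>\<omega>. (X \<omega>)\<^sup>2 \<partial>P)" and "b = (\<integral>\<omega>. X \<omega> * Y \<omega> \<partial>P)" and "c = (\<integral>\<omega>. (Y \<omega>)\<^sup>2 \<partial>P)"
  note i = square_integrable_mult[OF assms]
  have q: "0 \<le> a - 2 * t * b + t\<^sup>2 * c" for t
  proof -
    have "0 \<le> (\<integral>\<omega>. (X \<omega> - t * Y \<omega>)\<^sup>2 \<partial>P)" by simp
    also have "\<dots> = (\<integral>\<omega>. (X \<omega>)\<^sup>2 - 2 * t * (X \<omega> * Y \<omega>) + t\<^sup>2 * (Y \<omega>)\<^sup>2 \<partial>P)"
      by (rule Bochner_Integration.integral_cong) (auto simp: power2_eq_square algebra_simps)
    also have "\<dots> = a - 2 * t * b + t\<^sup>2 * c"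
      using i assms by (simp add: square_integrable_def a_def b_def c_def)
    finally show ?thesis .
  qed
  have "0 \<le> c" by (auto simp: c_def)
  show ?thesis
  proof (cases "c = 0")
    case True
    have "AE \<omega> in P. (Y \<omega>)\<^sup>2 = 0"
      using assms True by (subst integral_nonneg_eq_0_iff_AE[symmetric]) (auto simp: square_integrable_def c_def)
    then have "AE \<omega> in P. X \<omega> * Y \<omega> = 0" by eventually_elim simp
    then have "(\<integral>\<omega>. X \<omega> * Y \<omega> \<partial>P) = (\<integral>\<omega>. 0 \<partial>P)"
      using i by (intro integral_cong_AE) auto
    then show ?thesis by simp
  next
    case False
    with \<open>0 \<le> c\<close> have "c > 0" by simp
    \<comment> \<open>The value t = b / c minimizes the quadratic polynomial.\<close>
    have "0 \<le> a - 2 * (b / c) * b + (b / c)\<^sup>2 * c" by (rule q)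
    also have "\<dots> = a - b\<^sup>2 / c" using \<open>c > 0\<close> by (simp add: power2_eq_square field_simps)
    finally have "b\<^sup>2 \<le> a * c" using \<open>c > 0\<close> by (simp add: field_simps)
    then have "b \<le> sqrt (a * c)" using real_le_rsqrt by blast
    then show ?thesis by (simp add: real_sqrt_mult a_def b_def c_def)
  qed
qed

section \<open>Bounded variables and their fourth moments\<close>

definition bounded_rv :: "'a measure \<Rightarrow> ('a \<Rightarrow> real) \<Rightarrow> bool" where
  "bounded_rv P X \<longleftrightarrow> X \<in> borel_measurable P \<and> (\<exists>C. \<forall>\<omega>\<in>space P. \<bar>X \<omega>\<bar> \<le> C)"

lemma bounded_rv_add:
  assumes "bounded_rv P X" "bounded_rv P Y"
  shows "bounded_rv P (\<lambda>\<omega>. X \<omega> + Y \<omega>)"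
proof -
  obtain B C where "\<forall>\<omega>\<in>space P. \<bar>X \<omega>\<bar> \<le> B" "\<forall>\<omega>\<in>space P. \<bar>Y \<omega>\<bar> \<le> C"
    using assms by (auto simp: bounded_rv_def)
  then have "\<forall>\<omega>\<in>space P. \<bar>X \<omega> + Y \<omega>\<bar> \<le> B + C"
    by (auto intro!: order_trans[OF abs_triangle_ineq] add_mono)
  then show ?thesis using assms by (auto simp: bounded_rv_def)
qed

lemma bounded_rv_mult:
  assumes "bounded_rv P X" "bounded_rv P Y"
  shows "bounded_rv P (\<lambda>\<omega>. X \<omega> * Y \<omega>)"
proof -
  obtain B C where BC: "\<forall>\<omega>\<in>space P. \<bar>X \<omega>\<bar> \<le> B" "\<forall>\<omega>\<in>space P. \<bar>Y \<omega>\<bar> \<le> C"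
    using assms by (auto simp: bounded_rv_def)
  have "\<forall>\<omega>\<in>space P. \<bar>X \<omega> * Y \<omega>\<bar> \<le> B * C"
    unfolding abs_mult using BC by (intro ballI mult_mono) (auto intro: order_trans[OF abs_ge_zero])
  then show ?thesis using assms by (auto simp: bounded_rv_def)
qed

lemma bounded_rv_power:
  assumes "bounded_rv P X"
  shows "bounded_rv P (\<lambda>\<omega>. X \<omega> ^ k)"
proof (induction k)
  case 0
  show ?case by (auto simp: bounded_rv_def)
next
  case (Suc k)
  then show ?case using bounded_rv_mult[OF assms Suc] by simp
qed

lemma bounded_rv_sum:
  assumes "\<And>i. i \<in> I \<Longrightarrow> bounded_rv P (X i)"
  shows "bounded_rv P (\<lambda>\<omega>. \<Sum>i\<in>I. X i \<omega>)"
  using assms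
proof (induction I rule: infinite_finite_induct)
  case (insert i I)
  then show ?case using bounded_rv_add[of P "X i" "\<lambda>\<omega>. \<Sum>i\<in>I. X i \<omega>"] by simp
qed (auto simp: bounded_rv_def)

lemma bounded_rv_integrable:
  assumes "prob_space P" "bounded_rv P X"
  shows "integrable P X"
proof -
  interpret prob_space P by fact
  obtain C where "\<forall>\<omega>\<in>space P. \<bar>X \<omega>\<bar> \<le> C" using assms by (auto simp: bounded_rv_def)
  then show ?thesis
    using assms by (intro integrable_const_bound[of _ C]) (auto simp: bounded_rv_def)
qed

lemma bounded_rv_square_integrable:
  assumes "prob_space P" "bounded_rv P X"
  shows "square_integrable P X"
  using assms bounded_rv_integrable[OF assms(1) bounded_rv_power[OF assms(2), of 2]]
  by (auto simp: square_integrable_def bounded_rv_def)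

text \<open>In terms of the squared L4 norm a martingale step costs only an additive term. Iterating
  it over n bounded steps gives a fourth moment of order n^2; the triangle inequality in L4 would
  give n^4.\<close>

lemma fourth_moment_step:
  assumes P: "prob_space P" and G: "subalgebra P G" and bd: "bounded_rv P S" "bounded_rv P D"
    and S: "S \<in> borel_measurable G" and D: "centered P G D"
  shows "sqrt (\<integral>\<omega>. (S \<omega> + D \<omega>) ^ 4 \<partial>P) \<le> sqrt (\<integral>\<omega>. S \<omega> ^ 4 \<partial>P) + 4 * sqrt (\<integral>\<omega>. D \<omega> ^ 4 \<partial>P)"
proof -
  define s b where "s = sqrt (\<integral>\<omega>. S \<omega> ^ 4 \<partial>P)" and "b = sqrt (\<integral>\<omega>. D \<omega> ^ 4 \<partial>P)"
  have pow: "x ^ 4 = (x\<^sup>2)\<^sup>2" for x :: real by simp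
  have pos: "0 \<le> (\<integral>\<omega>. S \<omega> ^ 4 \<partial>P)" "0 \<le> (\<integral>\<omega>. D \<omega> ^ 4 \<partial>P)" by auto
  then have sb: "(\<integral>\<omega>. S \<omega> ^ 4 \<partial>P) = s\<^sup>2" "(\<integral>\<omega>. D \<omega> ^ 4 \<partial>P) = b\<^sup>2" "0 \<le> s" "0 \<le> b"
    by (auto simp: s_def b_def)
  have i: "integrable P (\<lambda>\<omega>. S \<omega> ^ 4)" "integrable P (\<lambda>\<omega>. D \<omega> ^ 4)" "integrable P (\<lambda>\<omega>. S \<omega> ^ 3 * D \<omega>)"
    "integrable P (\<lambda>\<omega>. (S \<omega>)\<^sup>2 * (D \<omega>)\<^sup>2)" "integrable P (\<lambda>\<omega>. (S \<omega> + D \<omega>) ^ 4)"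
    by (intro bounded_rv_integrable P bounded_rv_power bounded_rv_mult bounded_rv_add bd)+
  have zero: "(\<integral>\<omega>. S \<omega> ^ 3 * D \<omega> \<partial>P) = 0"
    by (rule centered_integral[OF P G D _ i(3)]) (use S in simp)
  have "(\<integral>\<omega>. (S \<omega>)\<^sup>2 * (D \<omega>)\<^sup>2 \<partial>P) \<le> sqrt (\<integral>\<omega>. ((S \<omega>)\<^sup>2)\<^sup>2 \<partial>P) * sqrt (\<integral>\<omega>. ((D \<omega>)\<^sup>2)\<^sup>2 \<partial>P)"
    by (intro Cauchy_Schwarz_integral bounded_rv_square_integrable P bounded_rv_power bd)
  then have cs: "(\<integral>\<omega>. (S \<omega>)\<^sup>2 * (D \<omega>)\<^sup>2 \<partial>P) \<le> s * b"
    unfolding s_def b_def pow .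
  \<comment> \<open>The term 4 x y^3 has no definite sign; the square below bounds it by 2 x^2 y^2 +
    2 y^4, which raises the coefficients 6 and 1 to 8 and 3.\<close>
  have "(x + y) ^ 4 \<le> x ^ 4 + 4 * (x ^ 3 * y) + 8 * (x\<^sup>2 * y\<^sup>2) + 3 * y ^ 4" for x y :: real
  proof -
    have "0 \<le> 2 * (x * y - y\<^sup>2)\<^sup>2" by simp
    then show ?thesis by (simp add: power4_eq_xxxx power3_eq_cube power2_eq_square algebra_simps)
  qed
  then have "(\<integral>\<omega>. (S \<omega> + D \<omega>) ^ 4 \<partial>P) \<le> (\<integral>\<omega>. S \<omega> ^ 4 + 4 * (S \<omega> ^ 3 * D \<omega>) + 8 * ((S \<omega>)\<^sup>2 * (D \<omega>)\<^sup>2) + 3 * D \<omega> ^ 4 \<partial>P)"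
    using i by (intro integral_mono) auto
  also have "\<dots> = s\<^sup>2 + 8 * (\<integral>\<omega>. (S \<omega>)\<^sup>2 * (D \<omega>)\<^sup>2 \<partial>P) + 3 * b\<^sup>2"
    using i zero sb by simp
  \<comment> \<open>The mixed term 8 s b forces the square (s + 4 b)^2. This is the origin of the
    factor 4 in the conclusion.\<close>
  also have "\<dots> \<le> s\<^sup>2 + 8 * (s * b) + 16 * b\<^sup>2"
  proof -
    have "3 * b\<^sup>2 \<le> 16 * b\<^sup>2" by simp
    with cs show ?thesis by (intro add_mono mult_left_mono) auto
  qed
  also have "\<dots> = (s + 4 * b)\<^sup>2" by (simp add: power2_eq_square algebra_simps)
  finally have "(\<integral>\<omega>. (S \<omega> + D \<omega>) ^ 4 \<partial>P) \<le> (s + 4 * b)\<^sup>2" .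
  then have "sqrt (\<integral>\<omega>. (S \<omega> + D \<omega>) ^ 4 \<partial>P) \<le> sqrt ((s + 4 * b)\<^sup>2)" by (rule real_sqrt_le_mono)
  also have "\<dots> = s + 4 * b" using sb(3,4) by simp
  finally show ?thesis unfolding s_def b_def .
qed

lemma sum_idx_upd_Suc:
  "(\<Sum>i\<in>{1..idx_upd a q (Suc k)}. f i)
    = (\<Sum>i\<in>{1..idx_upd a q k}. f i) + (\<Sum>i\<in>{i \<in> {1..idx_upd a q (Suc k)}. i $ q = Suc k}. f i)"
  for a :: "nat ^ 'd::finite" and f :: "nat ^ 'd \<Rightarrow> real"
proof -
  define A where "A = {i \<in> {1..idx_upd a q (Suc k)}. i $ q = Suc k}"
  have le: "i \<le> idx_upd a q m \<longleftrightarrow> i $ q \<le> m \<and> (\<forall>r. r \<noteq> q \<longrightarrow> i $ r \<le> a $ r)" for i m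
    by (auto simp: less_eq_vec_def)
  have "i \<le> idx_upd a q (Suc k) \<longleftrightarrow> i \<le> idx_upd a q k \<or> i \<le> idx_upd a q (Suc k) \<and> i $ q = Suc k" for i
    unfolding le by (auto simp: le_Suc_eq)
  then have un: "{1..idx_upd a q (Suc k)} = {1..idx_upd a q k} \<union> A"
    unfolding A_def set_eq_iff Un_iff mem_Collect_eq atLeastAtMost_iff by blast
  have "i $ q \<noteq> Suc k" if "i \<le> idx_upd a q k" for i
    using that unfolding le by auto
  then have "{1..idx_upd a q k} \<inter> A = {}" by (auto simp: A_def)
  moreover have "finite A"
    by (rule finite_subset[OF _ finite_idx_atLeastAtMost[of 1 "idx_upd a q (Suc k)"]]) (auto simp: A_def)
  ultimately have "(\<Sum>i\<in>{1..idx_upd a q (Suc k)}. f i) = (\<Sum>i\<in>{1..idx_upd a q k}. f i) + (\<Sum>i\<in>A. f i)"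
    unfolding un by (intro sum.union_disjoint finite_idx_atLeastAtMost)
  then show ?thesis unfolding A_def .
qed

subsection \<open>Fields of orthomartingale differences\<close>

text \<open>\<open>G q k\<close> plays the role of the information available when the \<open>q\<close>-th coordinate is at most \<open>k\<close>
  and the others are unrestricted.\<close>

locale difference_field = prob_space P for P :: "'a measure" +
  fixes G :: "'d::finite \<Rightarrow> nat \<Rightarrow> 'a measure" and N :: "nat ^ 'd" and X :: "nat ^ 'd \<Rightarrow> 'a \<Rightarrow> real"
  assumes subalg: "subalgebra P (G q k)"
    and mono_subalg: "j \<le> k \<Longrightarrow> sets (G q j) \<subseteq> sets (G q k)"
    and adapted: "i \<in> {1..N} \<Longrightarrow> X i \<in> borel_measurable (G q (i $ q))"
    and centered_difference: "i \<in> {1..N} \<Longrightarrow> centered P (G q (i $ q - 1)) (X i)"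
begin

lemma adapted_le:
  assumes "i \<in> {1..N}" "i $ q \<le> k"
  shows "X i \<in> borel_measurable (G q k)"
proof -
  have "subalgebra (G q k) (G q (i $ q))"
    using subalg[of q "i $ q"] subalg[of q k] mono_subalg[OF assms(2), of q]
    by (auto simp: subalgebra_def)
  then show ?thesis using adapted[OF assms(1), of q] by (rule measurable_from_subalg)
qed

text \<open>The iteration common to both moment bounds. It is applied to the second moment with C =
  1 and to the square root of the fourth moment with C = 4; L is the class of variables on which the
  one-step estimate is available. Layers are added one at a time in one coordinate after the other,
  and each coordinate costs one factor C.\<close>

lemma sum_step_bound:
  fixes \<rho> :: "('a \<Rightarrow> real) \<Rightarrow> real" and L :: "('a \<Rightarrow> real) \<Rightarrow> bool"
  assumes L: "\<And>i. i \<in> {1..N} \<Longrightarrow> L (X i)" "L (\<lambda>_. 0)"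
      "\<And>X Y. L X \<Longrightarrow> L Y \<Longrightarrow> L (\<lambda>\<omega>. X \<omega> + Y \<omega>)"
    and \<rho>0: "\<rho> (\<lambda>_. 0) = 0" and C: "C \<ge> 0"
    and step: "\<And>H S D. subalgebra P H \<Longrightarrow> L S \<Longrightarrow> L D \<Longrightarrow> S \<in> borel_measurable H \<Longrightarrow>
      centered P H D \<Longrightarrow> \<rho> (\<lambda>\<omega>. S \<omega> + D \<omega>) \<le> \<rho> S + C * \<rho> D"
  shows "\<rho> (\<lambda>\<omega>. \<Sum>i\<in>{1..N}. X i \<omega>) \<le> C ^ CARD('d) * (\<Sum>i\<in>{1..N}. \<rho> (X i))"
proof -
  have Lsum: "L (\<lambda>\<omega>. \<Sum>i\<in>I. X i \<omega>)" if "I \<subseteq> {1..N}" for I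
  proof -
    have "finite I" using that finite_subset finite_idx_atLeastAtMost by blast
    then show ?thesis using that
    proof (induction I rule: finite_induct)
      case (insert i I)
      then show ?case using L(3)[of "X i" "\<lambda>\<omega>. \<Sum>i\<in>I. X i \<omega>"] L(1)[of i] by simp
    qed (simp add: L(2))
  qed
  \<comment> \<open>The fibre through i in the directions of Q, growing from {i} to the whole
    box.\<close>
  define J where "J Q i = {j \<in> {1..N}. \<forall>r. r \<notin> Q \<longrightarrow> j $ r = i $ r}" for Q i
  have fin: "finite (J Q i)" for Q i
    by (rule finite_subset[OF _ finite_idx_atLeastAtMost[of 1 N]]) (auto simp: J_def)
  have "\<forall>i\<in>{1..N}. \<rho> (\<lambda>\<omega>. \<Sum>j\<in>J Q i. X j \<omega>) \<le> C ^ card Q * (\<Sum>j\<in>J Q i. \<rho> (X j))" if "finite Q" for Q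
    using that
  proof (induction Q rule: finite_induct)
    case empty
    have "J {} i = {i}" if "i \<in> {1..N}" for i using that by (auto simp: J_def vec_eq_iff)
    then show ?case by simp
  next
    case (insert q Q)
    show ?case
    proof
      fix i assume i: "i \<in> {1..N}"
      define A where "A m = {j \<in> J (insert q Q) i. j $ q \<le> m}" for m
      have finA: "finite (A m)" for m using fin by (auto simp: A_def)
      have "\<rho> (\<lambda>\<omega>. \<Sum>j\<in>A m. X j \<omega>) \<le> C * C ^ card Q * (\<Sum>j\<in>A m. \<rho> (X j))" if "m \<le> N $ q" for m
        using that
      proof (induction m)
        case 0
        have "1 \<le> j $ q" if "j \<in> {1..N}" for j using that by (simp add: less_eq_vec_def)
        then have "A 0 = {}" by (force simp: A_def J_def)
        then show ?case by (simp add: \<rho>0)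
      next
        case (Suc m)
        \<comment> \<open>Base point of the layer at height \<open>Suc m\<close>. The induction
          hypothesis is needed there and not at i, which is why the claim is proved for all base
          points together.\<close>
        define i' where "i' = idx_upd i q (Suc m)"
        have i': "i' \<in> {1..N}" using i Suc(2) by (simp add: i'_def less_eq_vec_def)
        have AS: "A (Suc m) = A m \<union> J Q i'" and disj: "A m \<inter> J Q i' = {}"
          using insert(2) by (auto simp: A_def J_def i'_def le_Suc_eq)
        have sums: "(\<Sum>j\<in>A (Suc m). f j) = (\<Sum>j\<in>A m. f j) + (\<Sum>j\<in>J Q i'. f j)" for f :: "nat ^ 'd \<Rightarrow> real"
          unfolding AS by (rule sum.union_disjoint[OF finA fin disj])
        have "\<rho> (\<lambda>\<omega>. \<Sum>j\<in>A (Suc m). X j \<omega>) \<le> \<rho> (\<lambda>\<omega>. \<Sum>j\<in>A m. X j \<omega>) + C * \<rho> (\<lambda>\<omega>. \<Sum>j\<in>J Q i'. X j \<omega>)"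
          unfolding sums
        proof (rule step[OF subalg[of q m]])
          show "L (\<lambda>\<omega>. \<Sum>j\<in>A m. X j \<omega>)" "L (\<lambda>\<omega>. \<Sum>j\<in>J Q i'. X j \<omega>)"
            by (intro Lsum; auto simp: A_def J_def)+
          show "(\<lambda>\<omega>. \<Sum>j\<in>A m. X j \<omega>) \<in> borel_measurable (G q m)"
            by (intro borel_measurable_sum adapted_le) (auto simp: A_def J_def)
          have "centered P (G q m) (X j)" if "j \<in> J Q i'" for j
          proof -
            have "j $ q = Suc m" using that insert(2) by (auto simp: J_def i'_def)
            then show ?thesis using centered_difference[of j q] that by (auto simp: J_def)
          qed
          then show "centered P (G q m) (\<lambda>\<omega>. \<Sum>j\<in>J Q i'. X j \<omega>)"
            by (intro centered_sum prob_space_axioms subalg)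
        qed
        also have "\<dots> \<le> C * C ^ card Q * (\<Sum>j\<in>A m. \<rho> (X j)) + C * (C ^ card Q * (\<Sum>j\<in>J Q i'. \<rho> (X j)))"
          using Suc insert(3) i' C by (intro add_mono mult_left_mono) auto
        also have "\<dots> = C * C ^ card Q * (\<Sum>j\<in>A (Suc m). \<rho> (X j))"
          unfolding sums by (simp add: algebra_simps)
        finally show ?case .
      qed
      from this[of "N $ q"] have "\<rho> (\<lambda>\<omega>. \<Sum>j\<in>A (N $ q). X j \<omega>) \<le> C * C ^ card Q * (\<Sum>j\<in>A (N $ q). \<rho> (X j))" by simp
      moreover have "A (N $ q) = J (insert q Q) i" by (auto simp: A_def J_def less_eq_vec_def)
      ultimately show "\<rho> (\<lambda>\<omega>. \<Sum>j\<in>J (insert q Q) i. X j \<omega>) \<le> C ^ card (insert q Q) * (\<Sum>j\<in>J (insert q Q) i. \<rho> (X j))"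
        using insert by simp
    qed
  qed
  moreover have "J UNIV i = {1..N}" for i by (auto simp: J_def)
  ultimately have *: "\<forall>i\<in>{1..N}. \<rho> (\<lambda>\<omega>. \<Sum>j\<in>{1..N}. X j \<omega>) \<le> C ^ CARD('d) * (\<Sum>j\<in>{1..N}. \<rho> (X j))"
    using finite[of UNIV] by metis
  \<comment> \<open>An empty box offers no base point for the claim above, so it is treated on its
    own.\<close>
  show ?thesis
  proof (cases "{1..N} = {}")
    case True
    show ?thesis unfolding True using \<rho>0 by simp
  next
    case False
    then show ?thesis using * by blast
  qed
qed

definition partial_sum :: "nat ^ 'd \<Rightarrow> 'a \<Rightarrow> real" where
  "partial_sum a \<omega> = (\<Sum>i\<in>{1..a}. X i \<omega>)"

lemma partial_sum_measurable:
  assumes "a \<le> N"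
  shows "partial_sum a \<in> borel_measurable (G q (a $ q))"
  unfolding partial_sum_def
proof (intro borel_measurable_sum adapted_le)
  fix i assume "i \<in> {1..a}"
  then show "i \<in> {1..N}" "i $ q \<le> a $ q" using assms by (auto simp: less_eq_vec_def intro: order_trans)
qed

lemma partial_sum_step:
  assumes "a \<le> N" "k < N $ q"
  obtains D where "\<And>\<omega>. partial_sum (idx_upd a q (Suc k)) \<omega> = partial_sum (idx_upd a q k) \<omega> + D \<omega>"
    and "centered P (G q k) D"
proof
  define A where "A = {i \<in> {1..idx_upd a q (Suc k)}. i $ q = Suc k}"
  show "partial_sum (idx_upd a q (Suc k)) \<omega> = partial_sum (idx_upd a q k) \<omega> + (\<Sum>i\<in>A. X i \<omega>)" for \<omega>
    unfolding partial_sum_def A_def by (rule sum_idx_upd_Suc)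
  have "idx_upd a q (Suc k) \<le> N" using assms by (auto simp: less_eq_vec_def)
  then have "centered P (G q k) (X i)" if "i \<in> A" for i
    using centered_difference[of i q] that by (auto simp: A_def)
  then show "centered P (G q k) (\<lambda>\<omega>. \<Sum>i\<in>A. X i \<omega>)"
    by (intro centered_sum prob_space_axioms subalg)
qed

text \<open>Used with V = |S| for second moments and V = S^2 for fourth moments, so the L2
  inequality serves both.\<close>

lemma max_tail:
  assumes V0: "\<And>a \<omega>. a \<le> N \<Longrightarrow> \<omega> \<in> space P \<Longrightarrow> 0 \<le> V a \<omega>"
    and V2: "\<And>a. a \<le> N \<Longrightarrow> square_integrable P (V a)"
    and sub: "\<And>a q k. a \<le> N \<Longrightarrow> k < N $ q \<Longrightarrow>
      submartingale_step P (G q k) (V (idx_upd a q k)) (V (idx_upd a q (Suc k)))"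
    and c: "c > 0"
  shows "{\<omega> \<in> space P. \<exists>a\<le>N. c \<le> V a \<omega>} \<in> events"
    and "prob {\<omega> \<in> space P. \<exists>a\<le>N. c \<le> V a \<omega>} \<le> 4 ^ CARD('d) * expectation (\<lambda>\<omega>. (V N \<omega>)\<^sup>2) / c\<^sup>2"
proof -
  define U where "U \<omega> = Max ((\<lambda>a. V a \<omega>) ` {..N})" for \<omega>
  have U2: "square_integrable P U"
    unfolding U_def by (intro square_integrable_Max V2) auto
  then have U: "U \<in> borel_measurable P" "integrable P (\<lambda>\<omega>. (U \<omega>)\<^sup>2)" by (auto simp: square_integrable_def)
  have "(\<exists>a\<le>N. c \<le> V a \<omega>) \<longleftrightarrow> c \<le> U \<omega>" for \<omega>
    unfolding U_def by (subst Max_ge_iff) auto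
  then have eq: "{\<omega> \<in> space P. \<exists>a\<le>N. c \<le> V a \<omega>} = {\<omega> \<in> space P. c \<le> U \<omega>}" by simp
  show "{\<omega> \<in> space P. \<exists>a\<le>N. c \<le> V a \<omega>} \<in> events"
    unfolding eq using U by auto
  have "prob {\<omega> \<in> space P. c \<le> U \<omega>} \<le> prob {\<omega> \<in> space P. c\<^sup>2 \<le> (U \<omega>)\<^sup>2}"
    using U c by (intro finite_measure_mono) (auto simp: power_mono)
  also have "\<dots> \<le> expectation (\<lambda>\<omega>. (U \<omega>)\<^sup>2) / c\<^sup>2"
    using c by (intro integral_Markov_inequality_measure[OF U(2), of "{}"]) auto
  also have "\<dots> \<le> 4 ^ CARD('d) * expectation (\<lambda>\<omega>. (V N \<omega>)\<^sup>2) / c\<^sup>2"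
    unfolding U_def
    by (intro divide_right_mono cairoli_L2[OF prob_space_axioms subalg mono_subalg V0 V2 sub]) auto
  finally show "prob {\<omega> \<in> space P. \<exists>a\<le>N. c \<le> V a \<omega>} \<le> 4 ^ CARD('d) * expectation (\<lambda>\<omega>. (V N \<omega>)\<^sup>2) / c\<^sup>2"
    unfolding eq .
qed

lemma max_tail_second_moment:
  assumes X2: "\<And>i. i \<in> {1..N} \<Longrightarrow> square_integrable P (X i)" and c: "c > 0"
  shows "{\<omega> \<in> space P. \<exists>a\<le>N. c \<le> \<bar>partial_sum a \<omega>\<bar>} \<in> events"
    and "prob {\<omega> \<in> space P. \<exists>a\<le>N. c \<le> \<bar>partial_sum a \<omega>\<bar>}
      \<le> 4 ^ CARD('d) * (\<Sum>i\<in>{1..N}. expectation (\<lambda>\<omega>. (X i \<omega>)\<^sup>2)) / c\<^sup>2"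
proof -
  have S2: "square_integrable P (partial_sum a)" if "a \<le> N" for a
    unfolding partial_sum_def by (intro square_integrable_sum X2) (use that in auto)
  have abs: "square_integrable P (\<lambda>\<omega>. \<bar>partial_sum a \<omega>\<bar>)" if "a \<le> N" for a
    using S2[OF that] by (auto simp: square_integrable_def)
  have sub: "submartingale_step P (G q k) (\<lambda>\<omega>. \<bar>partial_sum (idx_upd a q k) \<omega>\<bar>) (\<lambda>\<omega>. \<bar>partial_sum (idx_upd a q (Suc k)) \<omega>\<bar>)"
    if a: "a \<le> N" "k < N $ q" for a q k
  proof -
    from a obtain D where D: "\<And>\<omega>. partial_sum (idx_upd a q (Suc k)) \<omega> = partial_sum (idx_upd a q k) \<omega> + D \<omega>"
      "centered P (G q k) D" by (rule partial_sum_step) blast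
    have u: "idx_upd a q k \<le> N" using a by (auto simp: less_eq_vec_def)
    show ?thesis unfolding D(1)
      using partial_sum_measurable[OF u, of q]
      by (intro submartingale_step_abs prob_space_axioms subalg D square_integrable_integrable S2 u) simp
  qed
  note t = max_tail[of "\<lambda>a \<omega>. \<bar>partial_sum a \<omega>\<bar>", OF _ abs sub c, unfolded power2_abs]
  show "{\<omega> \<in> space P. \<exists>a\<le>N. c \<le> \<bar>partial_sum a \<omega>\<bar>} \<in> events" by (rule t(1)) simp
  have "prob {\<omega> \<in> space P. \<exists>a\<le>N. c \<le> \<bar>partial_sum a \<omega>\<bar>} \<le> 4 ^ CARD('d) * expectation (\<lambda>\<omega>. (partial_sum N \<omega>)\<^sup>2) / c\<^sup>2"
    by (rule t(2)) simp
  also have "expectation (\<lambda>\<omega>. (partial_sum N \<omega>)\<^sup>2) \<le> 1 ^ CARD('d) * (\<Sum>i\<in>{1..N}. expectation (\<lambda>\<omega>. (X i \<omega>)\<^sup>2))"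
    unfolding partial_sum_def
  proof (rule sum_step_bound[where L = "square_integrable P" and \<rho> = "\<lambda>Y. expectation (\<lambda>\<omega>. (Y \<omega>)\<^sup>2)"])
    show "square_integrable P (\<lambda>_. 0)" by (simp add: square_integrable_def)
  qed (simp_all add: square_integrable_add X2 second_moment_step[OF prob_space_axioms])
  finally show "prob {\<omega> \<in> space P. \<exists>a\<le>N. c \<le> \<bar>partial_sum a \<omega>\<bar>}
      \<le> 4 ^ CARD('d) * (\<Sum>i\<in>{1..N}. expectation (\<lambda>\<omega>. (X i \<omega>)\<^sup>2)) / c\<^sup>2"
    using c by (simp add: divide_right_mono mult_left_mono)
qed

lemma max_tail_fourth_moment:
  assumes Xb: "\<And>i. i \<in> {1..N} \<Longrightarrow> bounded_rv P (X i)" and c: "c > 0"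
  shows "{\<omega> \<in> space P. \<exists>a\<le>N. c \<le> \<bar>partial_sum a \<omega>\<bar>} \<in> events"
    and "prob {\<omega> \<in> space P. \<exists>a\<le>N. c \<le> \<bar>partial_sum a \<omega>\<bar>}
      \<le> 4 ^ CARD('d) * (4 ^ CARD('d) * (\<Sum>i\<in>{1..N}. sqrt (expectation (\<lambda>\<omega>. X i \<omega> ^ 4))))\<^sup>2 / c ^ 4"
proof -
  have Sb: "bounded_rv P (partial_sum a)" if "a \<le> N" for a
    unfolding partial_sum_def by (intro bounded_rv_sum Xb) (use that in auto)
  have sq: "square_integrable P (\<lambda>\<omega>. (partial_sum a \<omega>)\<^sup>2)" if "a \<le> N" for a
    by (intro bounded_rv_square_integrable prob_space_axioms bounded_rv_power Sb that)
  have sub: "submartingale_step P (G q k) (\<lambda>\<omega>. (partial_sum (idx_upd a q k) \<omega>)\<^sup>2) (\<lambda>\<omega>. (partial_sum (idx_upd a q (Suc k)) \<omega>)\<^sup>2)"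
    if a: "a \<le> N" "k < N $ q" for a q k
  proof -
    from a obtain D where D: "\<And>\<omega>. partial_sum (idx_upd a q (Suc k)) \<omega> = partial_sum (idx_upd a q k) \<omega> + D \<omega>"
      "centered P (G q k) D" by (rule partial_sum_step) blast
    have u: "idx_upd a q k \<le> N" "idx_upd a q (Suc k) \<le> N" using a by (auto simp: less_eq_vec_def)
    \<comment> \<open>\<open>partial_sum_step\<close> supplies only the centering of D; its square
      integrability is read off from the two partial sums.\<close>
    have "D = (\<lambda>\<omega>. partial_sum (idx_upd a q (Suc k)) \<omega> - partial_sum (idx_upd a q k) \<omega>)"
      using D(1) by auto
    then have D2: "square_integrable P D"
      using square_integrable_diff[OF bounded_rv_square_integrable bounded_rv_square_integrable,
          OF prob_space_axioms Sb[OF u(2)] prob_space_axioms Sb[OF u(1)]] by simp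
    show ?thesis unfolding D(1)
      using partial_sum_measurable[OF u(1), of q]
      by (intro submartingale_step_square prob_space_axioms subalg D D2 bounded_rv_square_integrable Sb u) simp
  qed
  have c2: "c\<^sup>2 > 0" using c by simp
  have eq: "c\<^sup>2 \<le> (partial_sum a \<omega>)\<^sup>2 \<longleftrightarrow> c \<le> \<bar>partial_sum a \<omega>\<bar>" for a \<omega>
    using c abs_le_square_iff[of c "partial_sum a \<omega>"] by simp
  note t = max_tail[of "\<lambda>a \<omega>. (partial_sum a \<omega>)\<^sup>2", OF _ sq sub c2, unfolded eq]
  show "{\<omega> \<in> space P. \<exists>a\<le>N. c \<le> \<bar>partial_sum a \<omega>\<bar>} \<in> events" by (rule t(1)) simp
  define b where "b = 4 ^ CARD('d) * (\<Sum>i\<in>{1..N}. sqrt (expectation (\<lambda>\<omega>. X i \<omega> ^ 4)))"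
  have "sqrt (expectation (\<lambda>\<omega>. partial_sum N \<omega> ^ 4)) \<le> b"
    unfolding partial_sum_def b_def
  proof (rule sum_step_bound[where L = "bounded_rv P" and \<rho> = "\<lambda>Y. sqrt (expectation (\<lambda>\<omega>. Y \<omega> ^ 4))"])
    show "bounded_rv P (\<lambda>_. 0)" by (auto simp: bounded_rv_def)
  qed (simp_all add: bounded_rv_add Xb fourth_moment_step[OF prob_space_axioms])
  then have b: "expectation (\<lambda>\<omega>. partial_sum N \<omega> ^ 4) \<le> b\<^sup>2" by (rule sqrt_le_D)
  have "prob {\<omega> \<in> space P. \<exists>a\<le>N. c \<le> \<bar>partial_sum a \<omega>\<bar>} \<le> 4 ^ CARD('d) * expectation (\<lambda>\<omega>. ((partial_sum N \<omega>)\<^sup>2)\<^sup>2) / (c\<^sup>2)\<^sup>2"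
    by (rule t(2)) simp
  also have "\<dots> = 4 ^ CARD('d) * expectation (\<lambda>\<omega>. partial_sum N \<omega> ^ 4) / c ^ 4"
    by simp
  also have "\<dots> \<le> 4 ^ CARD('d) * b\<^sup>2 / c ^ 4"
    using b by (intro divide_right_mono mult_left_mono) auto
  finally show "prob {\<omega> \<in> space P. \<exists>a\<le>N. c \<le> \<bar>partial_sum a \<omega>\<bar>} \<le> 4 ^ CARD('d) * b\<^sup>2 / c ^ 4" .
qed

end

subsection \<open>Commuting filtrations\<close>

lemma centered_subalgebra:
  assumes "prob_space P" "subalgebra P G" "subalgebra G H" "centered P G X"
  shows "centered P H X"
proof -
  have PH: "subalgebra P H" using assms(2,3) by (auto simp: subalgebra_def)
  interpret finite_measure_subalgebra P H
    using assms(1) PH by (rule prob_space_subalgebra)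
  have X: "integrable P X" "AE \<omega> in P. real_cond_exp P G X \<omega> = 0"
    using assms(4) by (auto simp: centered_def)
  have "AE \<omega> in P. real_cond_exp P H (real_cond_exp P G X) \<omega> = real_cond_exp P H X \<omega>"
    by (rule real_cond_exp_nested_subalg[OF assms(2,3) X(1)])
  moreover have "AE \<omega> in P. real_cond_exp P H (real_cond_exp P G X) \<omega> = real_cond_exp P H (\<lambda>_. 0) \<omega>"
    using X by (intro real_cond_exp_cong) auto
  moreover have "AE \<omega> in P. real_cond_exp P H (\<lambda>_. 0) \<omega> = 0"
    by (rule real_cond_exp_F_meas) auto
  ultimately have "AE \<omega> in P. real_cond_exp P H X \<omega> = 0" by eventually_elim auto
  then show ?thesis using X by (simp add: centered_def)
qed

lemma idx_meet_le: "idx_meet k l \<le> k" "idx_meet k l \<le> l"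
  by (auto simp: idx_meet_def less_eq_vec_def)

lemma idx_meet_commute: "idx_meet k l = idx_meet l k"
  by (auto simp: idx_meet_def min.commute)

lemma commuting_filtration_subalgebra:
  assumes "commuting_filtration P F"
  shows "subalgebra P (F i)" and "i \<le> j \<Longrightarrow> subalgebra (F j) (F i)"
  using assms by (auto simp: commuting_filtration_def multi_filtration_def subalgebra_def)

text \<open>Commutation is assumed for bounded variables only. It is used for the indicator of a set of
  \<open>F k\<close> and carried over to \<open>Y\<close> by the self-adjointness of conditional expectations.\<close>

lemma commuting_cond_exp:
  fixes F :: "nat ^ 'd::finite \<Rightarrow> 'a measure"
  assumes P: "prob_space P" and F: "commuting_filtration P F"
    and Y: "integrable P Y" "Y \<in> borel_measurable (F l)"
  shows "AE \<omega> in P. real_cond_exp P (F k) Y \<omega> = real_cond_exp P (F (idx_meet k l)) Y \<omega>"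
proof -
  note sub = commuting_filtration_subalgebra[OF F]
  define H where "H = F (idx_meet k l)"
  interpret prob_space P by fact
  interpret Fk: finite_measure_subalgebra P "F k" using P sub(1) by (rule prob_space_subalgebra)
  interpret Fl: finite_measure_subalgebra P "F l" using P sub(1) by (rule prob_space_subalgebra)
  interpret H: finite_measure_subalgebra P H unfolding H_def using P sub(1) by (rule prob_space_subalgebra)
  have HF: "subalgebra (F k) H" "subalgebra (F l) H"
    unfolding H_def by (intro sub(2) idx_meet_le)+
  have Yint: "integrable P (real_cond_exp P H Y)" using Y by (intro H.real_cond_exp_int)
  have "AE \<omega> in P. real_cond_exp P (F k) Y \<omega> = real_cond_exp P H Y \<omega>"
  proof (rule Fk.real_cond_exp_charact)
    show "real_cond_exp P H Y \<in> borel_measurable (F k)"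
      by (rule measurable_from_subalg[OF HF(1)]) simp
    fix A assume A: "A \<in> sets (F k)"
    then have AP: "A \<in> sets P" using sub(1)[of k] by (auto simp: subalgebra_def)
    let ?I = "indicat_real A"
    have Im: "?I \<in> borel_measurable (F k)" "?I \<in> borel_measurable P" using A AP by auto
    have "AE \<omega> in P. real_cond_exp P (F l) ?I \<omega> = real_cond_exp P (F (idx_meet l k)) ?I \<omega>"
    proof -
      have "\<exists>C. \<forall>\<omega>\<in>space P. \<bar>?I \<omega>\<bar> \<le> C"
        by (rule exI[of _ 1]) (simp split: split_indicator)
      then show ?thesis using F Im(1) unfolding commuting_filtration_def by blast
    qed
    then have eq: "AE \<omega> in P. real_cond_exp P (F l) ?I \<omega> = real_cond_exp P H ?I \<omega>"
      unfolding H_def by (subst idx_meet_commute)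
    have i1: "integrable P (\<lambda>\<omega>. Y \<omega> * ?I \<omega>)"
      using integrable_mult_indicator[OF AP Y(1)] by (simp add: mult.commute)
    have i2: "integrable P (\<lambda>\<omega>. real_cond_exp P H Y \<omega> * ?I \<omega>)"
      using integrable_mult_indicator[OF AP Yint] by (simp add: mult.commute)
    note l = Fl.real_cond_exp_intg[OF i1 Y(2) Im(2)]
    have YP: "Y \<in> borel_measurable P" using Y by auto
    have ae: "AE \<omega> in P. Y \<omega> * real_cond_exp P (F l) ?I \<omega> = real_cond_exp P H ?I \<omega> * Y \<omega>"
      using eq by eventually_elim simp
    have i3: "integrable P (\<lambda>\<omega>. real_cond_exp P H ?I \<omega> * Y \<omega>)"
      by (rule integrable_cong_AE_imp[OF l(1)]) (use ae YP in auto)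
    have "(\<integral>\<omega>. Y \<omega> * ?I \<omega> \<partial>P) = (\<integral>\<omega>. Y \<omega> * real_cond_exp P (F l) ?I \<omega> \<partial>P)"
      using l(2) by simp
    also have "\<dots> = (\<integral>\<omega>. real_cond_exp P H ?I \<omega> * Y \<omega> \<partial>P)"
      by (rule integral_cong_AE) (use ae YP in auto)
    also have "\<dots> = (\<integral>\<omega>. real_cond_exp P H ?I \<omega> * real_cond_exp P H Y \<omega> \<partial>P)"
      by (rule H.real_cond_exp_intg(2)[symmetric, OF i3 _ YP]) simp
    also have "\<dots> = (\<integral>\<omega>. real_cond_exp P H Y \<omega> * real_cond_exp P H ?I \<omega> \<partial>P)"
      by (simp add: mult.commute)
    also have "\<dots> = (\<integral>\<omega>. real_cond_exp P H Y \<omega> * ?I \<omega> \<partial>P)"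
      by (rule H.real_cond_exp_intg(2)[OF i2 _ Im(2)]) simp
    finally show "(\<integral>\<omega>\<in>A. Y \<omega> \<partial>P) = (\<integral>\<omega>\<in>A. real_cond_exp P H Y \<omega> \<partial>P)"
      by (simp add: set_lebesgue_integral_def mult.commute)
  qed (use Y Yint in auto)
  then show ?thesis unfolding H_def .
qed

text \<open>The identity through which commutation enters: it makes conditioning on the
  n-independent index \<open>idx_upd N q k\<close> the same as conditioning just below n in
  direction q.\<close>

lemma idx_meet_upd:
  assumes "n \<le> N" "k \<le> n $ q"
  shows "idx_meet (idx_upd N q k) n = idx_upd n q k"
  using assms by (auto simp: idx_meet_def less_eq_vec_def vec_eq_iff min_def intro: antisym)

text \<open>Carries a conditional expectation from the local sigma-algebra
  \<open>F (idx_upd n q k)\<close> to \<open>F (idx_upd N q k)\<close>, which does not depend on the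
  other coordinates of n. Commutation takes care of Y; Z is measurable for the larger sigma-algebra
  and is reproduced by it.\<close>

lemma centered_difference_idx:
  fixes F :: "nat ^ 'd::finite \<Rightarrow> 'a measure"
  assumes P: "prob_space P" and F: "commuting_filtration P F"
    and Y: "integrable P Y" "Y \<in> borel_measurable (F n)"
    and Z: "integrable P Z" "Z \<in> borel_measurable (F (idx_upd n q k))"
    and eq: "AE \<omega> in P. real_cond_exp P (F (idx_upd n q k)) Y \<omega> = Z \<omega>"
    and n: "n \<le> N" "k \<le> n $ q"
  shows "centered P (F (idx_upd N q k)) (\<lambda>\<omega>. Y \<omega> - Z \<omega>)"
proof -
  note sub = commuting_filtration_subalgebra[OF F]
  interpret finite_measure_subalgebra P "F (idx_upd N q k)"
    using P sub(1) by (rule prob_space_subalgebra)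
  have "AE \<omega> in P. real_cond_exp P (F (idx_upd N q k)) (\<lambda>\<omega>. Y \<omega> - Z \<omega>) \<omega>
      = real_cond_exp P (F (idx_upd N q k)) Y \<omega> - real_cond_exp P (F (idx_upd N q k)) Z \<omega>"
    using Y Z by (intro real_cond_exp_diff)
  moreover have "AE \<omega> in P. real_cond_exp P (F (idx_upd N q k)) Y \<omega> = real_cond_exp P (F (idx_upd n q k)) Y \<omega>"
    using commuting_cond_exp[OF P F Y, of "idx_upd N q k"] idx_meet_upd[OF n] by simp
  moreover have "Z \<in> borel_measurable (F (idx_upd N q k))"
    by (rule measurable_from_subalg[OF sub(2) Z(2)]) (use n in \<open>auto simp: less_eq_vec_def\<close>)
  then have "AE \<omega> in P. real_cond_exp P (F (idx_upd N q k)) Z \<omega> = Z \<omega>"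
    using Z(1) by (intro real_cond_exp_F_meas)
  ultimately have "AE \<omega> in P. real_cond_exp P (F (idx_upd N q k)) (\<lambda>\<omega>. Y \<omega> - Z \<omega>) \<omega> = 0"
    using eq by eventually_elim auto
  then show ?thesis using Y Z by (auto simp: centered_def)
qed

section \<open>Orthomartingales and their differences\<close>

lemma idx_not_ge_1: "\<not> 1 \<le> n \<longleftrightarrow> (\<exists>q. n $ q = 0)" for n :: "nat ^ 'd"
  by (simp add: less_eq_vec_def not_le)

text \<open>At indices with a zero coordinate the empty sum agrees with the convention that M
  vanishes, so increments from the boundary of the box need no separate treatment.\<close>

lemma orthomartingale_eq_sum:
  assumes M: "orthomartingale P F M" and D: "orthomartingale_differences P M D" and \<omega>: "\<omega> \<in> space P"
  shows "M a \<omega> = (\<Sum>i\<in>{1..a}. D i \<omega>)"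
proof (cases "1 \<le> a")
  case True
  then show ?thesis using D \<omega> by (auto simp: orthomartingale_differences_def)
next
  case False
  then obtain r where "a $ r = 0" unfolding idx_not_ge_1 ..
  then have "M a \<omega> = 0" using M \<omega> unfolding orthomartingale_def by blast
  moreover have "{1..a} = {}" using False by simp
  ultimately show ?thesis by simp
qed

lemma orthomartingale_measurable:
  fixes F :: "nat ^ 'd::finite \<Rightarrow> 'a measure"
  assumes F: "commuting_filtration P F" and M: "orthomartingale P F M"
  shows "M n \<in> borel_measurable (F n)" "integrable P (M n)"
proof -
  have "M n \<in> borel_measurable (F n) \<and> integrable P (M n)"
  proof (cases "1 \<le> n")
    case True
    then show ?thesis using M by (auto simp: orthomartingale_def)
  next
    case False
    then obtain q where "n $ q = 0" unfolding idx_not_ge_1 ..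
    then have 0: "\<And>\<omega>. \<omega> \<in> space P \<Longrightarrow> M n \<omega> = 0" using M unfolding orthomartingale_def by blast
    have "space (F n) = space P" using commuting_filtration_subalgebra(1)[OF F] by (auto simp: subalgebra_def)
    then have "M n \<in> borel_measurable (F n) \<longleftrightarrow> (\<lambda>_. 0 :: real) \<in> borel_measurable (F n)"
      by (intro measurable_cong) (simp add: 0)
    moreover have "integrable P (M n) \<longleftrightarrow> integrable P (\<lambda>_. 0 :: real)"
      by (rule Bochner_Integration.integrable_cong) (simp_all add: 0)
    ultimately show ?thesis by simp
  qed
  then show "M n \<in> borel_measurable (F n)" "integrable P (M n)" by auto
qed

text \<open>Provides the induction measure for the coordinatewise order.\<close>

lemma card_atMost_idx_less:
  assumes "i \<le> n" "i \<noteq> (n :: nat ^ 'd::finite)"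
  shows "card {..i} < card {..n}"
proof (rule psubset_card_mono)
  have "n \<notin> {..i}" using assms by auto
  then show "{..i} \<subset> {..n}" using assms(1) by auto
qed simp

text \<open>The differences are given only through their sums. Solving the equation at n for its top
  term and inducting over the indices below n avoids an inclusion-exclusion formula.\<close>

lemma orthomartingale_differences_measurable:
  fixes F :: "nat ^ 'd::finite \<Rightarrow> 'a measure"
  assumes F: "commuting_filtration P F" and M: "orthomartingale P F M"
    and D: "orthomartingale_differences P M D" and "1 \<le> n"
  shows "D n \<in> borel_measurable (F n)"
  using \<open>1 \<le> n\<close>
proof (induction "card {..n}" arbitrary: n rule: less_induct)
  case less
  note sub = commuting_filtration_subalgebra[OF F]
  have "D i \<in> borel_measurable (F n)" if "i \<in> {1..n} - {n}" for i
  proof (rule measurable_from_subalg[OF sub(2)])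
    show "D i \<in> borel_measurable (F i)"
      using that by (intro less card_atMost_idx_less) auto
    show "i \<le> n" using that by auto
  qed
  then have "(\<lambda>\<omega>. M n \<omega> - (\<Sum>i\<in>{1..n} - {n}. D i \<omega>)) \<in> borel_measurable (F n)"
    by (intro borel_measurable_diff borel_measurable_sum orthomartingale_measurable[OF F M])
  moreover have "M n \<omega> - (\<Sum>i\<in>{1..n} - {n}. D i \<omega>) = D n \<omega>" if "\<omega> \<in> space (F n)" for \<omega>
  proof -
    have "\<omega> \<in> space P" using that sub(1)[of n] by (auto simp: subalgebra_def)
    then have "M n \<omega> = (\<Sum>i\<in>{1..n}. D i \<omega>)" using D less(2) by (auto simp: orthomartingale_differences_def)
    moreover have "(\<Sum>i\<in>{1..n}. D i \<omega>) = D n \<omega> + (\<Sum>i\<in>{1..n} - {n}. D i \<omega>)"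
      using less(2) by (intro sum.remove) auto
    ultimately show ?thesis by simp
  qed
  ultimately show ?case using measurable_cong[of "F n"] by (metis (no_types, lifting))
qed

text \<open>The increment of M from n - e_q to n is centered by the martingale property and
  commutation. It is the sum of \<open>D i\<close> over a layer in direction q; all indices of this
  layer share the q-th coordinate, hence the same sigma-algebra, and all but n are covered by
  induction.\<close>

lemma orthomartingale_differences_centered:
  fixes F :: "nat ^ 'd::finite \<Rightarrow> 'a measure"
  assumes P: "prob_space P" and F: "commuting_filtration P F" and M: "orthomartingale P F M"
    and D: "orthomartingale_differences P M D" and n: "n \<in> {1..N}"
  shows "centered P (F (idx_upd N q (n $ q - 1))) (D n)"
  using n
proof (induction "card {..n}" arbitrary: n rule: less_induct)
  case less
  note sub = commuting_filtration_subalgebra[OF F]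
  define k where "k = n $ q - 1"
  have "1 \<le> n $ q" using less(2) by (auto simp: less_eq_vec_def)
  then have nk: "n $ q = Suc k" by (simp add: k_def)
  define A where "A = {i \<in> {1..n}. i $ q = Suc k}"
  have "A \<subseteq> {1..n}" by (auto simp: A_def)
  then have nA: "finite A" "n \<in> A"
    using less(2) nk finite_subset[OF _ finite_idx_atLeastAtMost[of 1 n]] by (auto simp: A_def)
  have upd: "idx_upd n q (Suc k) = n" by (metis nk idx_upd_triv)
  define n' where "n' = idx_upd n q k"
  have n': "n' \<le> n" using nk by (auto simp: n'_def less_eq_vec_def)
  have "centered P (F (idx_upd N q k)) (\<lambda>\<omega>. M n \<omega> - M n' \<omega>)"
    unfolding n'_def
  proof (rule centered_difference_idx[OF P F])
    have "AE \<omega> in P. real_cond_exp P (F n') (M n) \<omega> = M n' \<omega>"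
      using M n' by (auto simp: orthomartingale_def)
    then show "AE \<omega> in P. real_cond_exp P (F (idx_upd n q k)) (M n) \<omega> = M (idx_upd n q k) \<omega>"
      unfolding n'_def .
  qed (use less(2) nk orthomartingale_measurable[OF F M] in auto)
  moreover have "centered P (F (idx_upd N q k)) (D i)" if "i \<in> A - {n}" for i
  proof -
    have "centered P (F (idx_upd N q (i $ q - 1))) (D i)"
      using that less(2) by (intro less(1) card_atMost_idx_less) (auto simp: A_def)
    then show ?thesis using that by (simp add: A_def)
  qed
  then have "centered P (F (idx_upd N q k)) (\<lambda>\<omega>. \<Sum>i\<in>A - {n}. D i \<omega>)"
    by (intro centered_sum P sub)
  ultimately have "centered P (F (idx_upd N q k)) (\<lambda>\<omega>. (M n \<omega> - M n' \<omega>) - (\<Sum>i\<in>A - {n}. D i \<omega>))"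
    by (rule centered_diff[OF P sub(1)])
  moreover have "AE \<omega> in P. (M n \<omega> - M n' \<omega>) - (\<Sum>i\<in>A - {n}. D i \<omega>) = D n \<omega>"
  proof (rule AE_I2)
    fix \<omega> assume \<omega>: "\<omega> \<in> space P"
    note M_eq = orthomartingale_eq_sum[OF M D \<omega>]
    have "M n \<omega> = M n' \<omega> + (\<Sum>i\<in>A. D i \<omega>)"
      using sum_idx_upd_Suc[of "\<lambda>i. D i \<omega>" n q k] unfolding M_eq upd n'_def A_def .
    moreover have "(\<Sum>i\<in>A. D i \<omega>) = D n \<omega> + (\<Sum>i\<in>A - {n}. D i \<omega>)"
      using nA by (intro sum.remove) auto
    ultimately show "(M n \<omega> - M n' \<omega>) - (\<Sum>i\<in>A - {n}. D i \<omega>) = D n \<omega>" by simp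
  qed
  moreover have "D n \<in> borel_measurable P"
    using D less(2) by (auto simp: orthomartingale_differences_def)
  ultimately show ?case unfolding k_def[symmetric] by (rule centered_cong[OF P sub(1)])
qed

subsection \<open>Truncation\<close>

text \<open>\<open>Y\<close> is replaced by its image under the product over all coordinates \<open>q\<close> of the operators
  $Z \mapsto Z - E(Z \mid F_{n - e_q})$. Each of them keeps the centering in the other coordinates, since
  the filtration commutes, and does not increase the distance to \<open>X\<close>, which it fixes.\<close>

lemma bounded_projection:
  fixes F :: "nat ^ 'd::finite \<Rightarrow> 'a measure"
  assumes P: "prob_space P" and F: "commuting_filtration P F" and n: "n \<in> {1..N}"
    and X: "square_integrable P X"
      "\<And>q. centered P (F (idx_upd N q (n $ q - 1))) X"
    and Y: "Y \<in> borel_measurable (F n)" "\<And>\<omega>. \<omega> \<in> space P \<Longrightarrow> \<bar>Y \<omega>\<bar> \<le> C"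
  obtains Y' where "Y' \<in> borel_measurable (F n)" "\<And>\<omega>. \<omega> \<in> space P \<Longrightarrow> \<bar>Y' \<omega>\<bar> \<le> 2 ^ CARD('d) * C"
    "\<And>q. centered P (F (idx_upd N q (n $ q - 1))) Y'"
    "(\<integral>\<omega>. (X \<omega> - Y' \<omega>)\<^sup>2 \<partial>P) \<le> (\<integral>\<omega>. (X \<omega> - Y \<omega>)\<^sup>2 \<partial>P)"
proof -
  note sub = commuting_filtration_subalgebra[OF F]
  interpret prob_space P by fact
  have bdd: "bounded_rv P Z" if "Z \<in> borel_measurable (F m)" "\<And>\<omega>. \<omega> \<in> space P \<Longrightarrow> \<bar>Z \<omega>\<bar> \<le> c" for Z c m
    using measurable_from_subalg[OF sub(1) that(1)] that(2) unfolding bounded_rv_def by blast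
  have "\<exists>Y'. Y' \<in> borel_measurable (F n) \<and> (\<forall>\<omega>\<in>space P. \<bar>Y' \<omega>\<bar> \<le> 2 ^ card Q * C)
    \<and> (\<forall>q\<in>Q. centered P (F (idx_upd N q (n $ q - 1))) Y')
    \<and> (\<integral>\<omega>. (X \<omega> - Y' \<omega>)\<^sup>2 \<partial>P) \<le> (\<integral>\<omega>. (X \<omega> - Y \<omega>)\<^sup>2 \<partial>P)" if "finite Q" for Q
    using that
  proof (induction Q rule: finite_induct)
    case empty
    show ?case using Y by (intro exI[of _ Y]) auto
  next
    case (insert q Q)
    then obtain Y' where Y': "Y' \<in> borel_measurable (F n)" "\<And>\<omega>. \<omega> \<in> space P \<Longrightarrow> \<bar>Y' \<omega>\<bar> \<le> 2 ^ card Q * C"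
      "\<And>q. q \<in> Q \<Longrightarrow> centered P (F (idx_upd N q (n $ q - 1))) Y'"
      "(\<integral>\<omega>. (X \<omega> - Y' \<omega>)\<^sup>2 \<partial>P) \<le> (\<integral>\<omega>. (X \<omega> - Y \<omega>)\<^sup>2 \<partial>P)" by blast
    define c where "c = 2 ^ card Q * C"
    define k where "k = n $ q - 1"
    define m where "m = idx_upd n q k"
    have nN: "n \<le> N" "k \<le> n $ q" using n by (auto simp: k_def)
    have mn: "m \<le> n" "m \<le> idx_upd N q k" using nN by (auto simp: m_def less_eq_vec_def)
    interpret Fm: finite_measure_subalgebra P "F m" using P sub(1) by (rule prob_space_subalgebra)
    have Y'b: "bounded_rv P Y'" using Y'(1,2) by (rule bdd)
    then have Y'i: "integrable P Y'" by (rule bounded_rv_integrable[OF P])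
    \<comment> \<open>clipping changes the conditional expectation only on a null set and makes the bound hold everywhere\<close>
    define Z where "Z \<omega> = max (- c) (min c (real_cond_exp P (F m) Y' \<omega>))" for \<omega>
    have Zm: "Z \<in> borel_measurable (F m)" unfolding Z_def by simp
    obtain \<omega>0 where "\<omega>0 \<in> space P" using not_empty by blast
    then have c0: "0 \<le> c" using Y'(2)[of \<omega>0] by (simp add: c_def)
    then have Zc: "\<bar>Z \<omega>\<bar> \<le> c" for \<omega> by (auto simp: Z_def)
    have Zb: "bounded_rv P Z" using Zm Zc by (rule bdd)
    then have Zi: "integrable P Z" by (rule bounded_rv_integrable[OF P])
    have "AE \<omega> in P. real_cond_exp P (F m) Y' \<omega> \<le> c"
      using Y'(2) Y'i by (intro Fm.real_cond_exp_le_c) (auto simp: c_def abs_le_iff)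
    moreover have "AE \<omega> in P. - c \<le> real_cond_exp P (F m) Y' \<omega>"
      using Y'(2) Y'i by (intro Fm.real_cond_exp_ge_c) (auto simp: c_def abs_le_iff minus_le_iff)
    ultimately have Zeq: "AE \<omega> in P. real_cond_exp P (F m) Y' \<omega> = Z \<omega>"
      by eventually_elim (simp add: Z_def)
    define Y'' where "Y'' \<omega> = Y' \<omega> - Z \<omega>" for \<omega>
    have cq: "centered P (F (idx_upd N q k)) Y''"
      unfolding Y''_def
      using centered_difference_idx[OF P F Y'i Y'(1) Zi _ _ nN] Zm Zeq unfolding m_def by blast
    have "centered P (F (idx_upd N r (n $ r - 1))) Y''" if r: "r \<in> Q" for r
    proof -
      define l where "l = n $ r - 1"
      have rq: "r \<noteq> q" using r insert(2) by auto
      \<comment> \<open>The meet of m and \<open>idx_upd N r l\<close>. The tower property makes Z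
        centered given \<open>F w\<close>, because Y' is; commutation then lifts this to
        \<open>F (idx_upd N r l)\<close>.\<close>
      define w where "w = idx_upd m r l"
      have mN: "m \<le> N" using mn nN by (meson order_trans)
      have l: "l \<le> m $ r" using rq by (simp add: m_def l_def)
      have cY': "centered P (F (idx_upd N r l)) Y'" using Y'(3)[OF r] by (simp add: l_def)
      have w: "w \<le> idx_upd N r l" "w \<le> m"
        using mN l by (auto simp: w_def less_eq_vec_def)
      have "centered P (F w) Y'"
        by (rule centered_subalgebra[OF P sub(1) sub(2)[OF w(1)] cY'])
      then have "AE \<omega> in P. real_cond_exp P (F w) Y' \<omega> = 0" by (simp add: centered_def)
      moreover
      interpret Fw: finite_measure_subalgebra P "F w" using P sub(1) by (rule prob_space_subalgebra)
      have "AE \<omega> in P. real_cond_exp P (F w) (real_cond_exp P (F m) Y') \<omega> = real_cond_exp P (F w) Y' \<omega>"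
        by (rule Fw.real_cond_exp_nested_subalg[OF sub(1) sub(2)[OF w(2)] Y'i])
      moreover have "AE \<omega> in P. real_cond_exp P (F w) (real_cond_exp P (F m) Y') \<omega> = real_cond_exp P (F w) Z \<omega>"
        using Zeq Zb by (intro Fw.real_cond_exp_cong) (auto simp: bounded_rv_def)
      ultimately have z: "AE \<omega> in P. real_cond_exp P (F w) Z \<omega> = 0"
        by eventually_elim simp
      have "centered P (F (idx_upd N r l)) (\<lambda>\<omega>. Z \<omega> - 0)"
        by (rule centered_difference_idx[OF P F Zi Zm _ _ _ mN l]) (use z in \<open>simp_all add: w_def\<close>)
      then have "centered P (F (idx_upd N r l)) Z" by simp
      with cY' show ?thesis unfolding Y''_def l_def by (intro centered_diff P sub)
    qed
    moreover have "Y'' \<in> borel_measurable (F n)"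
      unfolding Y''_def by (intro borel_measurable_diff Y' measurable_from_subalg[OF sub(2)[OF mn(1)] Zm])
    \<comment> \<open>Both Y' and Z are bounded by c, so each coordinate doubles the bound.\<close>
    moreover have "\<bar>Y'' \<omega>\<bar> \<le> 2 ^ card (insert q Q) * C" if "\<omega> \<in> space P" for \<omega>
      using Y'(2)[OF that] Zc[of \<omega>] insert by (simp add: Y''_def c_def)
    moreover have "(\<integral>\<omega>. (X \<omega> - Y'' \<omega>)\<^sup>2 \<partial>P) \<le> (\<integral>\<omega>. (X \<omega> - Y \<omega>)\<^sup>2 \<partial>P)"
    proof -
      have "Z \<in> borel_measurable (F (idx_upd N q k))"
        by (rule measurable_from_subalg[OF sub(2)[OF mn(2)] Zm])
      then have mZ: "(\<lambda>\<omega>. - Z \<omega>) \<in> borel_measurable (F (idx_upd N q k))" by simp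
      have Y''2: "square_integrable P Y''"
        unfolding Y''_def by (intro square_integrable_diff bounded_rv_square_integrable P Zb Y'b)
      have mZ2: "square_integrable P (\<lambda>\<omega>. - Z \<omega>)"
        using square_integrable_cmult[OF bounded_rv_square_integrable[OF P Zb], of "- 1"] by simp
      have W: "centered P (F (idx_upd N q k)) (\<lambda>\<omega>. X \<omega> - Y'' \<omega>)"
        using X(2)[of q] cq by (intro centered_diff P sub) (simp_all add: k_def)
      \<comment> \<open>Pythagoras: X - Y' is the sum of -Z, which is measurable for the
        conditioning sigma-algebra, and X - Y'', which is centered for it.\<close>
      have "(\<integral>\<omega>. (X \<omega> - Y'' \<omega>)\<^sup>2 \<partial>P) \<le> (\<integral>\<omega>. (- Z \<omega>)\<^sup>2 \<partial>P) + (\<integral>\<omega>. (X \<omega> - Y'' \<omega>)\<^sup>2 \<partial>P)"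
        by simp
      also have "\<dots> = (\<integral>\<omega>. (- Z \<omega> + (X \<omega> - Y'' \<omega>))\<^sup>2 \<partial>P)"
        using second_moment_step[OF P sub(1) mZ2 square_integrable_diff[OF X(1) Y''2] mZ W] by simp
      also have "\<dots> = (\<integral>\<omega>. (X \<omega> - Y' \<omega>)\<^sup>2 \<partial>P)" by (simp add: Y''_def)
      finally show ?thesis using Y'(4) by simp
    qed
    ultimately show ?case using cq unfolding k_def by (intro exI[of _ Y'']) blast
  qed
  from this[of UNIV] show thesis using that by auto
qed

section \<open>Stationarity and the choice of the truncation level\<close>

lemma strictly_stationary_distr:
  fixes D :: "nat ^ 'd::finite \<Rightarrow> 'a \<Rightarrow> real"
  assumes D: "strictly_stationary P D" and m: "\<And>n. 1 \<le> n \<Longrightarrow> D n \<in> borel_measurable P" and n: "1 \<le> n"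
  shows "distr P borel (D n) = distr P borel (D 1)"
proof -
  \<comment> \<open>The shift carrying 1 to n. One-point index sets suffice, as only marginal laws
    are compared.\<close>
  define h where "h = (\<chi> q. n $ q - 1)"
  have h: "1 + h = n" using n by (simp add: h_def vec_eq_iff less_eq_vec_def Suc_le_eq)
  let ?I = "{1 :: nat ^ 'd}"
  let ?M = "\<Pi>\<^sub>M i\<in>?I. (borel :: real measure)"
  have eq: "distr P ?M (\<lambda>\<omega>. \<lambda>i\<in>?I. D (i + h) \<omega>) = distr P ?M (\<lambda>\<omega>. \<lambda>i\<in>?I. D i \<omega>)"
    using D unfolding strictly_stationary_def by auto
  have c: "(\<lambda>x. x 1) \<in> measurable ?M borel" by simp
  have a: "(\<lambda>\<omega>. \<lambda>i\<in>?I. D (i + h) \<omega>) \<in> measurable P ?M" "(\<lambda>\<omega>. \<lambda>i\<in>?I. D i \<omega>) \<in> measurable P ?M"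
    using m n by (auto intro!: measurable_restrict simp: h)
  have "distr P borel (D n) = distr (distr P ?M (\<lambda>\<omega>. \<lambda>i\<in>?I. D (i + h) \<omega>)) borel (\<lambda>x. x 1)"
    by (subst distr_distr[OF c a(1)]) (simp add: comp_def h)
  also have "\<dots> = distr P borel (D 1)"
    unfolding eq by (subst distr_distr[OF c a(2)]) (simp add: comp_def)
  finally show ?thesis .
qed

lemma strictly_stationary_integral:
  fixes D :: "nat ^ 'd::finite \<Rightarrow> 'a \<Rightarrow> real" and f :: "real \<Rightarrow> real"
  assumes D: "strictly_stationary P D" and m: "\<And>n. 1 \<le> n \<Longrightarrow> D n \<in> borel_measurable P" and n: "1 \<le> n"
    and f: "f \<in> borel_measurable borel"
  shows "(\<integral>\<omega>. f (D n \<omega>) \<partial>P) = (\<integral>\<omega>. f (D 1 \<omega>) \<partial>P)"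
    and "integrable P (\<lambda>\<omega>. f (D n \<omega>)) \<longleftrightarrow> integrable P (\<lambda>\<omega>. f (D 1 \<omega>))"
proof -
  note eq = strictly_stationary_distr[OF D m n]
  show "(\<integral>\<omega>. f (D n \<omega>) \<partial>P) = (\<integral>\<omega>. f (D 1 \<omega>) \<partial>P)"
    using integral_distr[OF m[OF n] f] integral_distr[OF m[of 1] f] eq by simp
  show "integrable P (\<lambda>\<omega>. f (D n \<omega>)) \<longleftrightarrow> integrable P (\<lambda>\<omega>. f (D 1 \<omega>))"
    using integrable_distr_eq[OF m[OF n] f] integrable_distr_eq[OF m[of 1] f] eq by simp
qed

text \<open>The error vanishes once the level exceeds |X| and its square is dominated by X^2, so
  dominated convergence applies.\<close>

lemma truncation_error:
  fixes X :: "'a \<Rightarrow> real"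
  assumes X: "X \<in> borel_measurable P" "integrable P (\<lambda>\<omega>. (X \<omega>)\<^sup>2)" and e: "e > 0"
  obtains K :: real where "K > 0" "(\<integral>\<omega>. (X \<omega> - max (- K) (min K (X \<omega>)))\<^sup>2 \<partial>P) \<le> e"
proof -
  have "(\<lambda>k. \<integral>\<omega>. (X \<omega> - max (- real k) (min (real k) (X \<omega>)))\<^sup>2 \<partial>P) \<longlonglongrightarrow> (\<integral>\<omega>. 0 \<partial>P)"
  proof (rule integral_dominated_convergence[OF _ _ X(2)])
    show "AE \<omega> in P. (\<lambda>k. (X \<omega> - max (- real k) (min (real k) (X \<omega>)))\<^sup>2) \<longlonglongrightarrow> 0"
    proof (rule AE_I2)
      fix \<omega>
      have "\<forall>\<^sub>F k in sequentially. \<bar>X \<omega>\<bar> \<le> real k"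
        using filterlim_real_sequentially by (simp add: filterlim_at_top)
      then have "\<forall>\<^sub>F k in sequentially. (X \<omega> - max (- real k) (min (real k) (X \<omega>)))\<^sup>2 = 0"
        by eventually_elim (auto simp: abs_le_iff)
      then show "(\<lambda>k. (X \<omega> - max (- real k) (min (real k) (X \<omega>)))\<^sup>2) \<longlonglongrightarrow> 0"
        by (rule tendsto_eventually)
    qed
    show "AE \<omega> in P. norm ((X \<omega> - max (- real k) (min (real k) (X \<omega>)))\<^sup>2) \<le> (X \<omega>)\<^sup>2" for k
      by (rule AE_I2) (auto simp: abs_le_square_iff[symmetric])
  qed (use X in auto)
  then have "\<forall>\<^sub>F k in sequentially. (\<integral>\<omega>. (X \<omega> - max (- real k) (min (real k) (X \<omega>)))\<^sup>2 \<partial>P) < e"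
    using e by (simp add: order_tendsto_iff)
  moreover have "\<forall>\<^sub>F k::nat in sequentially. 0 < k" by (rule eventually_gt_at_top)
  ultimately have "\<forall>\<^sub>F k in sequentially. 0 < k \<and> (\<integral>\<omega>. (X \<omega> - max (- real k) (min (real k) (X \<omega>)))\<^sup>2 \<partial>P) < e"
    by eventually_elim simp
  then obtain k :: nat where "0 < k" "(\<integral>\<omega>. (X \<omega> - max (- real k) (min (real k) (X \<omega>)))\<^sup>2 \<partial>P) < e"
    by (auto dest!: eventually_happens)
  then show thesis using that[of "real k"] by simp
qed

text \<open>The point is the order of the quantifiers: stationarity lets the level chosen for
  \<open>D 1\<close> serve every n and every box N. The final K includes the factor 2^d lost in the
  projection.\<close>

lemma orthomartingale_differences_truncation:
  fixes F :: "nat ^ 'd::finite \<Rightarrow> 'a measure"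
  assumes P: "prob_space P" and F: "commuting_filtration P F" and M: "orthomartingale P F M"
    and D: "orthomartingale_differences P M D" and stat: "strictly_stationary P D"
    and D2: "integrable P (\<lambda>\<omega>. (D 1 \<omega>)\<^sup>2)" and e: "e > 0"
  obtains K :: real where "K > 0" "\<And>N n. n \<in> {1..N} \<Longrightarrow> \<exists>Y. Y \<in> borel_measurable (F n) \<and>
    (\<forall>\<omega>\<in>space P. \<bar>Y \<omega>\<bar> \<le> K) \<and> (\<forall>q. centered P (F (idx_upd N q (n $ q - 1))) Y) \<and>
    (\<integral>\<omega>. (D n \<omega> - Y \<omega>)\<^sup>2 \<partial>P) \<le> e"
proof -
  have Dm: "D n \<in> borel_measurable P" if "1 \<le> n" for n
    using D that by (auto simp: orthomartingale_differences_def)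
  obtain K where K: "K > 0" "(\<integral>\<omega>. (D 1 \<omega> - max (- K) (min K (D 1 \<omega>)))\<^sup>2 \<partial>P) \<le> e"
    using truncation_error[OF Dm[OF order_refl] D2 e] by blast
  have "\<exists>Y. Y \<in> borel_measurable (F n) \<and> (\<forall>\<omega>\<in>space P. \<bar>Y \<omega>\<bar> \<le> 2 ^ CARD('d) * K) \<and>
    (\<forall>q. centered P (F (idx_upd N q (n $ q - 1))) Y) \<and> (\<integral>\<omega>. (D n \<omega> - Y \<omega>)\<^sup>2 \<partial>P) \<le> e" if n: "n \<in> {1..N}" for N n
  proof -
    have n1: "1 \<le> n" using n by auto
    have "square_integrable P (D n)"
      using strictly_stationary_integral(2)[OF stat Dm n1, of "\<lambda>x. x\<^sup>2"] D2 Dm[OF n1]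
      by (simp add: square_integrable_def)
    moreover have "(\<lambda>\<omega>. max (- K) (min K (D n \<omega>))) \<in> borel_measurable (F n)"
      using orthomartingale_differences_measurable[OF F M D n1] by simp
    moreover have "\<bar>max (- K) (min K (D n \<omega>))\<bar> \<le> K" for \<omega>
      using K(1) by auto
    ultimately obtain Y where "Y \<in> borel_measurable (F n)" "\<And>\<omega>. \<omega> \<in> space P \<Longrightarrow> \<bar>Y \<omega>\<bar> \<le> 2 ^ CARD('d) * K"
      "\<And>q. centered P (F (idx_upd N q (n $ q - 1))) Y"
      "(\<integral>\<omega>. (D n \<omega> - Y \<omega>)\<^sup>2 \<partial>P) \<le> (\<integral>\<omega>. (D n \<omega> - max (- K) (min K (D n \<omega>)))\<^sup>2 \<partial>P)"
      using bounded_projection[OF P F n _ orthomartingale_differences_centered[OF P F M D n],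
          of "\<lambda>\<omega>. max (- K) (min K (D n \<omega>))" K] by blast
    moreover have "(\<integral>\<omega>. (D n \<omega> - max (- K) (min K (D n \<omega>)))\<^sup>2 \<partial>P) \<le> e"
      using strictly_stationary_integral(1)[OF stat Dm n1, of "\<lambda>x. (x - max (- K) (min K x))\<^sup>2"] K(2) by simp
    ultimately show ?thesis by (meson order_trans)
  qed
  then show thesis using K(1) by (intro that[of "2 ^ CARD('d) * K"]) auto
qed

subsection \<open>Increments over slabs\<close>

text \<open>The bounded part contributes a term quadratic in the size of B, the remainder a linear
  one with the small factor e. Each part receives half of the threshold c.\<close>

lemma slab_tail:
  fixes F :: "nat ^ 'd::finite \<Rightarrow> 'a measure" and K e c :: real
  assumes P: "prob_space P" and F: "commuting_filtration P F" and M: "orthomartingale P F M"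
    and D: "orthomartingale_differences P M D"
    and D2: "\<And>n. 1 \<le> n \<Longrightarrow> square_integrable P (D n)"
    and trunc: "\<And>n. n \<in> {1..N} \<Longrightarrow> \<exists>Y :: 'a \<Rightarrow> real. Y \<in> borel_measurable (F n) \<and>
      (\<forall>\<omega>\<in>space P. \<bar>Y \<omega>\<bar> \<le> K) \<and> (\<forall>q. centered P (F (idx_upd N q (n $ q - 1))) Y) \<and>
      (\<integral>\<omega>. (D n \<omega> - Y \<omega>)\<^sup>2 \<partial>P) \<le> e"
    and B: "B \<subseteq> {1..N}" and c: "c > 0" and K: "K \<ge> 0"
  shows "{\<omega> \<in> space P. \<exists>a\<le>N. c < \<bar>\<Sum>i\<in>{1..a} \<inter> B. D i \<omega>\<bar>} \<in> sets P"
    and "measure P {\<omega> \<in> space P. \<exists>a\<le>N. c < \<bar>\<Sum>i\<in>{1..a} \<inter> B. D i \<omega>\<bar>}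
      \<le> 4 ^ CARD('d) * (4 ^ CARD('d) * (card B * K\<^sup>2))\<^sup>2 / (c / 2) ^ 4
        + 4 ^ CARD('d) * (card B * e) / (c / 2)\<^sup>2"
proof -
  note sub = commuting_filtration_subalgebra[OF F]
  interpret prob_space P by fact
  have finB: "finite B" by (rule finite_subset[OF B]) simp
  obtain Y where Y: "\<And>n. n \<in> {1..N} \<Longrightarrow> Y n \<in> borel_measurable (F n)"
    "\<And>n \<omega>. n \<in> {1..N} \<Longrightarrow> \<omega> \<in> space P \<Longrightarrow> \<bar>Y n \<omega>\<bar> \<le> K"
    "\<And>n q. n \<in> {1..N} \<Longrightarrow> centered P (F (idx_upd N q (n $ q - 1))) (Y n)"
    "\<And>n. n \<in> {1..N} \<Longrightarrow> (\<integral>\<omega>. (D n \<omega> - Y n \<omega>)\<^sup>2 \<partial>P) \<le> e"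
  proof -
    have "\<forall>n\<in>{1..N}. \<exists>Y :: 'a \<Rightarrow> real. Y \<in> borel_measurable (F n) \<and>
      (\<forall>\<omega>\<in>space P. \<bar>Y \<omega>\<bar> \<le> K) \<and> (\<forall>q. centered P (F (idx_upd N q (n $ q - 1))) Y) \<and>
      (\<integral>\<omega>. (D n \<omega> - Y \<omega>)\<^sup>2 \<partial>P) \<le> e"
      using trunc by (rule ballI)
    from bchoice[OF this] obtain Y where "\<forall>n\<in>{1..N}. Y n \<in> borel_measurable (F n) \<and>
      (\<forall>\<omega>\<in>space P. \<bar>Y n \<omega>\<bar> \<le> K) \<and> (\<forall>q. centered P (F (idx_upd N q (n $ q - 1))) (Y n)) \<and>
      (\<integral>\<omega>. (D n \<omega> - Y n \<omega>)\<^sup>2 \<partial>P) \<le> e" ..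
    then show thesis by (intro that[of Y]) blast+
  qed
  have YP: "Y n \<in> borel_measurable P" if "n \<in> {1..N}" for n
    by (rule measurable_from_subalg[OF sub(1) Y(1)[OF that]])
  have Yb: "bounded_rv P (Y n)" if "n \<in> {1..N}" for n
    using YP[OF that] Y(2)[OF that] unfolding bounded_rv_def by blast
  \<comment> \<open>For indices in the box this sigma-algebra restricts coordinate q alone, since
    the others are already at their maximum.\<close>
  define G where "G q k = F (idx_upd N q k)" for q k
  \<comment> \<open>setting the field to 0 outside the slab keeps it a difference field, so no shifted filtration is needed\<close>
  define X where "X i = (if i \<in> B then Y i else (\<lambda>_. 0))" for i
  define X' where "X' i = (if i \<in> B then (\<lambda>\<omega>. D i \<omega> - Y i \<omega>) else (\<lambda>_. 0))" for i
  have up: "Z \<in> borel_measurable (G q (i $ q))"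
    if "i \<in> {1..N}" "Z \<in> borel_measurable (F i)" for i q and Z :: "'a \<Rightarrow> real"
    unfolding G_def by (rule measurable_from_subalg[OF sub(2) that(2)]) (use that(1) in \<open>auto simp: less_eq_vec_def\<close>)
  have G: "subalgebra P (G q k)" "j \<le> k \<Longrightarrow> sets (G q j) \<subseteq> sets (G q k)" for q j k
    using sub(1) F unfolding G_def commuting_filtration_def multi_filtration_def
    by (auto simp: less_eq_vec_def)
  have Dm: "D i \<in> borel_measurable (F i)" if "i \<in> {1..N}" for i
    using that by (intro orthomartingale_differences_measurable[OF F M D]) auto
  have Dc: "centered P (G q (i $ q - 1)) (D i)" if "i \<in> {1..N}" for i q
    unfolding G_def by (rule orthomartingale_differences_centered[OF P F M D that])
  interpret A: difference_field P G N X
  proof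
    fix i q assume i: "i \<in> {1..N}"
    show "X i \<in> borel_measurable (G q (i $ q))" unfolding X_def using up[OF i Y(1)[OF i]] by simp
    show "centered P (G q (i $ q - 1)) (X i)"
      unfolding X_def using Y(3)[OF i] centered_zero[OF P G(1)] by (simp add: G_def)
  qed (use G in auto)
  interpret A': difference_field P G N X'
  proof
    fix i q assume i: "i \<in> {1..N}"
    show "X' i \<in> borel_measurable (G q (i $ q))"
      unfolding X'_def using up[OF i Y(1)[OF i]] up[OF i Dm[OF i]] by simp
    show "centered P (G q (i $ q - 1)) (X' i)"
      unfolding X'_def using centered_diff[OF P G(1) Dc[OF i] Y(3)[OF i, of q, folded G_def]]
        centered_zero[OF P G(1)] by simp
  qed (use G in auto)
  have c2: "c / 2 > 0" using c by simp
  have Xb: "bounded_rv P (X i)" if "i \<in> {1..N}" for i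
    using Yb[OF that] unfolding X_def by (auto simp: bounded_rv_def)
  have X2: "square_integrable P (X' i)" if "i \<in> {1..N}" for i
    using square_integrable_diff[OF D2 bounded_rv_square_integrable[OF P Yb]] that
    unfolding X'_def by (auto simp: square_integrable_def)
  note tA = A.max_tail_fourth_moment[OF Xb c2]
  note tA' = A'.max_tail_second_moment[OF X2 c2]
  have sumB: "(\<Sum>i\<in>{1..a}. if i \<in> B then f i else 0) = (\<Sum>i\<in>{1..a} \<inter> B. f i)" for f :: "nat ^ 'd \<Rightarrow> real" and a
    by (rule sum.inter_restrict[symmetric]) simp
  have split: "(\<Sum>i\<in>{1..a} \<inter> B. D i \<omega>) = A.partial_sum a \<omega> + A'.partial_sum a \<omega>" for a \<omega>
    unfolding A.partial_sum_def A'.partial_sum_def X_def X'_def sumB[symmetric] sum.distrib[symmetric]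
    by (rule sum.cong) auto
  have "(\<Sum>i\<in>{1..N}. sqrt (expectation (\<lambda>\<omega>. X i \<omega> ^ 4))) \<le> (\<Sum>i\<in>{1..N}. if i \<in> B then K\<^sup>2 else 0)"
  proof (rule sum_mono)
    fix i assume i: "i \<in> {1..N}"
    have "expectation (\<lambda>\<omega>. Y i \<omega> ^ 4) \<le> expectation (\<lambda>\<omega>. (K\<^sup>2)\<^sup>2)"
    proof (rule integral_mono)
      show "integrable P (\<lambda>\<omega>. Y i \<omega> ^ 4)"
        by (intro bounded_rv_integrable P bounded_rv_power Yb i)
      fix \<omega> assume "\<omega> \<in> space P"
      then have "\<bar>Y i \<omega>\<bar> ^ 4 \<le> K ^ 4" using Y(2)[OF i] by (intro power_mono) auto
      then show "Y i \<omega> ^ 4 \<le> (K\<^sup>2)\<^sup>2" by simp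
    qed simp
    then have "sqrt (expectation (\<lambda>\<omega>. Y i \<omega> ^ 4)) \<le> K\<^sup>2"
      by (intro real_le_lsqrt) (auto simp: prob_space)
    then show "sqrt (expectation (\<lambda>\<omega>. X i \<omega> ^ 4)) \<le> (if i \<in> B then K\<^sup>2 else 0)"
      by (simp add: X_def)
  qed
  also have "\<dots> = card B * K\<^sup>2"
    unfolding sumB using B by (simp add: Int_absorb1)
  finally have s4: "(\<Sum>i\<in>{1..N}. sqrt (expectation (\<lambda>\<omega>. X i \<omega> ^ 4))) \<le> card B * K\<^sup>2" .
  have "(\<Sum>i\<in>{1..N}. expectation (\<lambda>\<omega>. (X' i \<omega>)\<^sup>2)) \<le> (\<Sum>i\<in>{1..N}. if i \<in> B then e else 0)"
    using Y(4) by (intro sum_mono) (simp add: X'_def)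
  also have "\<dots> = card B * e"
    unfolding sumB using B by (simp add: Int_absorb1)
  finally have s2: "(\<Sum>i\<in>{1..N}. expectation (\<lambda>\<omega>. (X' i \<omega>)\<^sup>2)) \<le> card B * e" .
  let ?E = "{\<omega> \<in> space P. \<exists>a\<le>N. c < \<bar>\<Sum>i\<in>{1..a} \<inter> B. D i \<omega>\<bar>}"
  let ?E1 = "{\<omega> \<in> space P. \<exists>a\<le>N. c / 2 \<le> \<bar>A.partial_sum a \<omega>\<bar>}"
  let ?E2 = "{\<omega> \<in> space P. \<exists>a\<le>N. c / 2 \<le> \<bar>A'.partial_sum a \<omega>\<bar>}"
  have "?E = (\<Union>a\<in>{..N}. {\<omega> \<in> space P. c < \<bar>\<Sum>i\<in>{1..a} \<inter> B. D i \<omega>\<bar>})" by auto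
  moreover have "(\<lambda>\<omega>. \<Sum>i\<in>{1..a} \<inter> B. D i \<omega>) \<in> borel_measurable P" for a
    using D2 by (intro borel_measurable_sum) (auto simp: square_integrable_def)
  then have "{\<omega> \<in> space P. c < \<bar>\<Sum>i\<in>{1..a} \<inter> B. D i \<omega>\<bar>} \<in> events" for a by measurable
  ultimately show E: "?E \<in> events" by (auto intro!: sets.finite_UN)
  have "?E \<subseteq> ?E1 \<union> ?E2"
  proof
    fix \<omega> assume "\<omega> \<in> ?E"
    then obtain a where a: "\<omega> \<in> space P" "a \<le> N" "c < \<bar>A.partial_sum a \<omega> + A'.partial_sum a \<omega>\<bar>"
      unfolding split by auto
    then have "c / 2 \<le> \<bar>A.partial_sum a \<omega>\<bar> \<or> c / 2 \<le> \<bar>A'.partial_sum a \<omega>\<bar>" by linarith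
    then show "\<omega> \<in> ?E1 \<union> ?E2" using a by auto
  qed
  then have "prob ?E \<le> prob (?E1 \<union> ?E2)"
    using tA(1) tA'(1) by (intro finite_measure_mono) auto
  also have "\<dots> \<le> prob ?E1 + prob ?E2"
    using tA(1) tA'(1) by (rule measure_Un_le)
  also have "\<dots> \<le> 4 ^ CARD('d) * (4 ^ CARD('d) * (\<Sum>i\<in>{1..N}. sqrt (expectation (\<lambda>\<omega>. X i \<omega> ^ 4))))\<^sup>2 / (c / 2) ^ 4
      + 4 ^ CARD('d) * (\<Sum>i\<in>{1..N}. expectation (\<lambda>\<omega>. (X' i \<omega>)\<^sup>2)) / (c / 2)\<^sup>2"
    using tA(2) tA'(2) by (rule add_mono)
  also have "\<dots> \<le> 4 ^ CARD('d) * (4 ^ CARD('d) * (card B * K\<^sup>2))\<^sup>2 / (c / 2) ^ 4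
        + 4 ^ CARD('d) * (card B * e) / (c / 2)\<^sup>2"
    using s4 s2 c2
    by (intro add_mono divide_right_mono mult_left_mono power_mono mult_nonneg_nonneg sum_nonneg) auto
  finally show "prob ?E \<le> 4 ^ CARD('d) * (4 ^ CARD('d) * (card B * K\<^sup>2))\<^sup>2 / (c / 2) ^ 4
        + 4 ^ CARD('d) * (card B * e) / (c / 2)\<^sup>2" .
qed

text \<open>Deterministic chaining: a is changed into b one coordinate at a time. Values at distance
  at most \<open>L q\<close> lie in the same or in neighbouring cells of mesh \<open>L q\<close>, so
  each change takes at most three comparisons with grid points.\<close>

lemma grid_increment:
  fixes f :: "nat ^ 'd::finite \<Rightarrow> real" and c :: real
  assumes L: "\<And>q. 0 < L q"
    and slab: "\<And>a q m. a \<le> N \<Longrightarrow> m * L q \<le> a $ q \<Longrightarrow> a $ q \<le> Suc m * L q \<Longrightarrow>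
      \<bar>f a - f (idx_upd a q (m * L q))\<bar> \<le> c"
    and ab: "a \<le> N" "b \<le> N" "\<And>q. a $ q \<le> b $ q + L q" "\<And>q. b $ q \<le> a $ q + L q"
  shows "\<bar>f a - f b\<bar> \<le> CARD('d) * (3 * c)"
proof -
  have c0: "0 \<le> c" using slab[of 0 0 undefined] by (simp add: less_eq_vec_def)
  have one: "\<bar>f (idx_upd a q l) - f (idx_upd a q k)\<bar> \<le> 3 * c"
    if a: "a \<le> N" and kl: "k \<le> l" "l \<le> k + L q" "l \<le> N $ q" for a q k l
  proof -
    define m where "m = k div L q"
    have k: "m * L q \<le> k" "k < Suc m * L q"
      using L[of q] by (auto simp: m_def div_times_less_eq_dividend dividend_less_div_times add.commute)
    have s: "\<bar>f (idx_upd a q j) - f (idx_upd a q (p * L q))\<bar> \<le> c"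
      if "j \<le> N $ q" "p * L q \<le> j" "j \<le> Suc p * L q" for j p
    proof -
      have "idx_upd a q j \<le> N" using a that(1) by (auto simp: less_eq_vec_def)
      from slab[OF this, of p q] that show ?thesis by simp
    qed
    have sk: "\<bar>f (idx_upd a q k) - f (idx_upd a q (m * L q))\<bar> \<le> c"
      using k kl by (intro s) auto
    show ?thesis
    proof (cases "l \<le> Suc m * L q")
      case True
      then have "\<bar>f (idx_upd a q l) - f (idx_upd a q (m * L q))\<bar> \<le> c"
        using k kl by (intro s) auto
      with sk c0 show ?thesis by linarith
    next
      case False
      then have "\<bar>f (idx_upd a q l) - f (idx_upd a q (Suc m * L q))\<bar> \<le> c"
        using k kl by (intro s) auto
      \<comment> \<open>Consecutive grid points can be compared because \<open>slab\<close> includes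
        the right end of the cell.\<close>
      moreover have "\<bar>f (idx_upd a q (Suc m * L q)) - f (idx_upd a q (m * L q))\<bar> \<le> c"
        using False kl by (intro s) auto
      ultimately show ?thesis using sk by linarith
    qed
  qed
  \<comment> \<open>The intermediate point of the chain: coordinates in Q have been moved to b, the
    others are still those of a.\<close>
  define w where "w Q = (\<chi> r. if r \<in> Q then b $ r else a $ r)" for Q
  have "\<bar>f a - f (w Q)\<bar> \<le> card Q * (3 * c)" if "finite Q" for Q
    using that
  proof (induction Q rule: finite_induct)
    case empty
    have "w {} = a" by (simp add: w_def vec_eq_iff)
    then show ?case by simp
  next
    case (insert q Q)
    have wN: "w Q \<le> N" using ab by (auto simp: w_def less_eq_vec_def)
    have "w (insert q Q) = idx_upd (w Q) q (b $ q)" "w Q = idx_upd (w Q) q (a $ q)"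
      using insert(2) by (auto simp: w_def vec_eq_iff)
    moreover have "\<bar>f (idx_upd (w Q) q (a $ q)) - f (idx_upd (w Q) q (b $ q))\<bar> \<le> 3 * c"
    proof (cases "a $ q \<le> b $ q")
      case True
      then show ?thesis
        using one[OF wN True ab(4)] ab(2) by (simp add: less_eq_vec_def abs_minus_commute)
    next
      case False
      then show ?thesis
        using one[OF wN _ ab(3)] ab(1) by (simp add: less_eq_vec_def)
    qed
    ultimately have "\<bar>f (w Q) - f (w (insert q Q))\<bar> \<le> 3 * c" by simp
    then show ?case using insert by (simp add: algebra_simps)
  qed
  from this[of UNIV] show ?thesis by (simp add: w_def)
qed

text \<open>The slab occupies a fraction of at most L / N_q of the box; multiplying out keeps the
  estimate in the natural numbers. It is an inequality since the last slab may reach beyond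
  N.\<close>

lemma card_slab:
  fixes N :: "nat ^ 'd::finite"
  shows "card {i \<in> {1..N}. m * L < i $ q \<and> i $ q \<le> Suc m * L} * N $ q \<le> L * idx_size N"
proof -
  define S where "S r = (if r = q then {m * L<..Suc m * L} else {1..N $ r})" for r
  let ?B = "{i \<in> {1..N}. m * L < i $ q \<and> i $ q \<le> Suc m * L}"
  have "?B \<subseteq> vec_lambda ` (PiE UNIV S)"
  proof
    fix i assume i: "i \<in> ?B"
    have "i = vec_lambda (\<lambda>r. i $ r)" by (simp add: vec_eq_iff)
    moreover have "(\<lambda>r. i $ r) \<in> PiE UNIV S"
      using i by (auto simp: S_def less_eq_vec_def)
    ultimately show "i \<in> vec_lambda ` (PiE UNIV S)" by blast
  qed
  moreover have fin: "finite (PiE UNIV S)" by (auto intro!: finite_PiE simp: S_def)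
  ultimately have "card ?B \<le> card (PiE UNIV S)"
    by (intro order_trans[OF card_mono card_image_le] finite_imageI)
  also have "\<dots> = (\<Prod>r\<in>UNIV. card (S r))" by (rule card_PiE) simp
  also have "\<dots> = card (S q) * (\<Prod>r\<in>UNIV - {q}. card (S r))" by (rule prod.remove) auto
  also have "\<dots> = L * (\<Prod>r\<in>UNIV - {q}. N $ r)" by (simp add: S_def)
  finally have "card ?B * N $ q \<le> L * (\<Prod>r\<in>UNIV - {q}. N $ r) * N $ q" by (rule mult_right_mono) simp
  also have "\<dots> = L * idx_size N"
    unfolding idx_size_def by (subst prod.remove[of UNIV q]) auto
  finally show ?thesis .
qed

lemma slab_sum:
  fixes f :: "nat ^ 'd::finite \<Rightarrow> real"
  assumes "a \<le> N" "m * L \<le> a $ q" "a $ q \<le> Suc m * L"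
  shows "(\<Sum>i\<in>{1..a} \<inter> {i \<in> {1..N}. m * L < i $ q \<and> i $ q \<le> Suc m * L}. f i)
    = (\<Sum>i\<in>{1..a}. f i) - (\<Sum>i\<in>{1..idx_upd a q (m * L)}. f i)"
proof -
  let ?B = "{1..a} \<inter> {i \<in> {1..N}. m * L < i $ q \<and> i $ q \<le> Suc m * L}"
  have le: "i \<le> idx_upd a q p \<longleftrightarrow> i $ q \<le> p \<and> (\<forall>r. r \<noteq> q \<longrightarrow> i $ r \<le> a $ r)" for i p
    by (auto simp: less_eq_vec_def)
  have le': "i \<le> a \<longleftrightarrow> i $ q \<le> a $ q \<and> (\<forall>r. r \<noteq> q \<longrightarrow> i $ r \<le> a $ r)" for i
    using le[of i "a $ q"] by simp
  have mem: "i \<in> {1..a} \<longleftrightarrow> i \<in> {1..idx_upd a q (m * L)} \<or> i \<in> ?B" for i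
  proof -
    have 1: "i \<le> N" if "i \<le> a" using that assms(1) by (rule order_trans)
    have 2: "i \<le> a \<longleftrightarrow> i \<le> idx_upd a q (m * L) \<or> i \<le> a \<and> m * L < i $ q"
      unfolding le le' using assms(2) by auto
    have 3: "i $ q \<le> Suc m * L" if "i \<le> a" using that assms(3) unfolding le' by linarith
    show ?thesis unfolding Int_iff mem_Collect_eq atLeastAtMost_iff
      by (cases "1 \<le> i"; cases "i \<le> a"; use 1 2 3 in \<open>simp only: simp_thms\<close>)
  qed
  have un: "{1..a} = {1..idx_upd a q (m * L)} \<union> ?B"
    by (rule set_eqI, subst Un_iff, rule mem)
  have disj: "{1..idx_upd a q (m * L)} \<inter> ?B = {}"
  proof (rule equals0I)
    fix i assume "i \<in> {1..idx_upd a q (m * L)} \<inter> ?B"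
    then have "i \<le> idx_upd a q (m * L)" "m * L < i $ q"
      unfolding Int_iff mem_Collect_eq atLeastAtMost_iff by simp_all
    then show False unfolding le by simp
  qed
  have "(\<Sum>i\<in>{1..a}. f i) = (\<Sum>i\<in>{1..idx_upd a q (m * L)}. f i) + (\<Sum>i\<in>?B. f i)"
    by (subst un, rule sum.union_disjoint[OF finite_idx_atLeastAtMost finite_Int disj])
      (rule disjI1, rule finite_idx_atLeastAtMost)
  then show ?thesis by simp
qed

subsection \<open>The modulus of continuity\<close>

text \<open>The size s of the box cancels. The constants are 144 = 16 * 3^2 and 12 = 4 * 3, from the
  halved threshold and the slab size 3 \<delta> s. The isolated factor \<delta> pays for the union
  over about 1 / \<delta> slabs.\<close>

lemma slab_tail_scaled:
  fixes s b \<delta> \<kappa> K e x :: real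
  assumes "s > 0" "\<kappa> > 0" "0 \<le> b" "b \<le> 3 * \<delta> * s" "0 \<le> e" "0 \<le> x"
  shows "x * (x * (b * K\<^sup>2))\<^sup>2 / (\<kappa> * sqrt s / 2) ^ 4 + x * (b * e) / (\<kappa> * sqrt s / 2)\<^sup>2
    \<le> \<delta> * (144 * x ^ 3 * K ^ 4 / \<kappa> ^ 4 * \<delta> + 12 * x / \<kappa>\<^sup>2 * e)"
proof -
  have s2: "(\<kappa> * sqrt s / 2)\<^sup>2 = \<kappa>\<^sup>2 * s / 4"
    using assms by (simp add: power_divide power_mult_distrib)
  have s4: "(\<kappa> * sqrt s / 2) ^ 4 = \<kappa> ^ 4 * s\<^sup>2 / 16"
  proof -
    have "(\<kappa> * sqrt s / 2) ^ 4 = ((\<kappa> * sqrt s / 2)\<^sup>2)\<^sup>2" by (simp flip: power_mult)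
    also have "\<dots> = \<kappa> ^ 4 * s\<^sup>2 / 16" unfolding s2 by (simp add: power_divide power_mult_distrib)
    finally show ?thesis .
  qed
  have "x * (x * (b * K\<^sup>2))\<^sup>2 / (\<kappa> ^ 4 * s\<^sup>2 / 16) \<le> x * (x * ((3 * \<delta> * s) * K\<^sup>2))\<^sup>2 / (\<kappa> ^ 4 * s\<^sup>2 / 16)"
    using assms by (intro divide_right_mono mult_left_mono power_mono mult_right_mono) auto
  also have "\<dots> = 144 * x ^ 3 * K ^ 4 / \<kappa> ^ 4 * \<delta>\<^sup>2"
    using assms by (simp add: field_simps power2_eq_square power3_eq_cube power4_eq_xxxx)
  finally have 1: "x * (x * (b * K\<^sup>2))\<^sup>2 / (\<kappa> * sqrt s / 2) ^ 4 \<le> 144 * x ^ 3 * K ^ 4 / \<kappa> ^ 4 * \<delta>\<^sup>2"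
    unfolding s4 .
  have "x * (b * e) / (\<kappa>\<^sup>2 * s / 4) \<le> x * ((3 * \<delta> * s) * e) / (\<kappa>\<^sup>2 * s / 4)"
    using assms by (intro divide_right_mono mult_left_mono mult_right_mono) auto
  also have "\<dots> = 12 * x / \<kappa>\<^sup>2 * e * \<delta>"
    using assms by (simp add: field_simps)
  finally have 2: "x * (b * e) / (\<kappa> * sqrt s / 2)\<^sup>2 \<le> 12 * x / \<kappa>\<^sup>2 * e * \<delta>"
    unfolding s2 .
  from add_mono[OF 1 2] show ?thesis
    by (simp add: algebra_simps power2_eq_square)
qed

lemma idx_floor_scale_le:
  fixes N :: "nat ^ 'd::finite"
  assumes "t \<in> {0..1}"
  shows "idx_floor (idx_scale t N) \<le> N"
proof -
  have "nat \<lfloor>t $ q * real (N $ q)\<rfloor> \<le> N $ q" for q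
  proof -
    have "t $ q \<le> 1" using assms by (auto simp: less_eq_vec_def)
    then have "t $ q * real (N $ q) \<le> 1 * real (N $ q)" by (intro mult_right_mono) auto
    then have "\<lfloor>t $ q * real (N $ q)\<rfloor> \<le> int (N $ q)" by linarith
    then show ?thesis by linarith
  qed
  then show ?thesis by (simp add: less_eq_vec_def idx_floor_def idx_scale_def)
qed

text \<open>Taking integer parts may cost one unit; as 1 is at most \<delta> N_q, doubling \<delta>
  absorbs it.\<close>

lemma idx_floor_scale_diff:
  fixes N :: "nat ^ 'd::finite"
  assumes st: "s \<in> {0..1}" "t \<in> {0..1}" "infnorm (s - t) < \<delta>"
    and \<delta>: "1 / \<delta> \<le> real (N $ q)" "\<delta> > 0"
  shows "idx_floor (idx_scale s N) $ q \<le> idx_floor (idx_scale t N) $ q + nat \<lceil>2 * \<delta> * real (N $ q)\<rceil>"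
proof -
  have "\<bar>(s - t) $ q\<bar> \<le> infnorm (s - t)" by (rule component_le_infnorm_cart)
  then have "s $ q \<le> t $ q + \<delta>" using st(3) by simp
  then have "s $ q * real (N $ q) \<le> (t $ q + \<delta>) * real (N $ q)" by (intro mult_right_mono) auto
  moreover have "1 \<le> \<delta> * real (N $ q)" using \<delta> by (simp add: field_simps)
  ultimately have "s $ q * real (N $ q) \<le> t $ q * real (N $ q) + 2 * \<delta> * real (N $ q) - 1"
    by (simp add: algebra_simps)
  then have "\<lfloor>s $ q * real (N $ q)\<rfloor> \<le> \<lfloor>t $ q * real (N $ q)\<rfloor> + \<lceil>2 * \<delta> * real (N $ q)\<rceil>" by linarith
  moreover have "0 \<le> t $ q * real (N $ q)" using st(2) by (auto simp: less_eq_vec_def)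
  ultimately show ?thesis by (simp add: idx_floor_def idx_scale_def)
qed

text \<open>The bound no longer contains N, which makes the upper limit immediate. The choice of
  \<kappa> compensates for the factor 3 d in \<open>grid_increment\<close>.\<close>

lemma modulus_tail:
  fixes F :: "nat ^ 'd::finite \<Rightarrow> 'a measure" and K e \<epsilon> \<delta> :: real
  assumes P: "prob_space P" and F: "commuting_filtration P F" and M: "orthomartingale P F M"
    and D: "orthomartingale_differences P M D"
    and D2: "\<And>n. 1 \<le> n \<Longrightarrow> square_integrable P (D n)"
    and trunc: "\<And>n. n \<in> {1..N} \<Longrightarrow> \<exists>Y :: 'a \<Rightarrow> real. Y \<in> borel_measurable (F n) \<and>
      (\<forall>\<omega>\<in>space P. \<bar>Y \<omega>\<bar> \<le> K) \<and> (\<forall>q. centered P (F (idx_upd N q (n $ q - 1))) Y) \<and>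
      (\<integral>\<omega>. (D n \<omega> - Y \<omega>)\<^sup>2 \<partial>P) \<le> e"
    and K: "K \<ge> 0" and e: "e \<ge> 0" and \<epsilon>: "\<epsilon> > 0" and \<delta>: "0 < \<delta>" "\<delta> \<le> 1 / 2"
    and N: "\<And>q. 1 / \<delta> \<le> real (N $ q)"
    and \<kappa>: "\<kappa> = \<epsilon> / (3 * CARD('d))"
  shows "measure P {\<omega> \<in> space P.
        (SUP (s, t) \<in> {(s, t). s \<in> {0..1} \<and> t \<in> {0..1} \<and> infnorm (s - t) < \<delta>}.
           ereal (\<bar>M (idx_floor (idx_scale s N)) \<omega> - M (idx_floor (idx_scale t N)) \<omega>\<bar>
                  / sqrt (real (idx_size N)))) > ereal \<epsilon>}
    \<le> CARD('d) * (144 * (4 ^ CARD('d)) ^ 3 * K ^ 4 / \<kappa> ^ 4 * \<delta> + 12 * 4 ^ CARD('d) / \<kappa>\<^sup>2 * e)"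
proof -
  interpret prob_space P by fact
  define R where "R = 144 * (4 ^ CARD('d)) ^ 3 * K ^ 4 / \<kappa> ^ 4 * \<delta> + 12 * 4 ^ CARD('d) / \<kappa>\<^sup>2 * e"
  have \<kappa>0: "\<kappa> > 0" unfolding \<kappa> using \<epsilon> by simp
  have R0: "R \<ge> 0" unfolding R_def using K e \<delta> \<kappa>0 by (intro add_nonneg_nonneg mult_nonneg_nonneg divide_nonneg_nonneg) auto
  have N0: "0 < N $ q" for q
  proof -
    have "0 < 1 / \<delta>" using \<delta> by simp
    also have "\<dots> \<le> real (N $ q)" by (rule N)
    finally show ?thesis by simp
  qed
  define s where "s = real (idx_size N)"
  have s0: "s > 0" unfolding s_def idx_size_def using N0 by (simp add: prod_pos)
  define c where "c = \<kappa> * sqrt s"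
  have c0: "c > 0" unfolding c_def using \<kappa>0 s0 by simp
  \<comment> \<open>The lower bound 2 \<delta> N_q covers the rounded increments and limits the
    number of slabs; the upper bound 3 \<delta> N_q limits their size.\<close>
  define L where "L q = nat \<lceil>2 * \<delta> * real (N $ q)\<rceil>" for q
  have dN: "1 \<le> \<delta> * real (N $ q)" for q using N[of q] \<delta> by (simp add: field_simps)
  have Lge: "2 * \<delta> * real (N $ q) \<le> real (L q)" for q unfolding L_def by linarith
  have Lle: "real (L q) \<le> 3 * \<delta> * real (N $ q)" for q
  proof -
    have "real (L q) \<le> 2 * \<delta> * real (N $ q) + 1" unfolding L_def using dN[of q] by linarith
    then show ?thesis using dN[of q] by linarith
  qed
  have L0: "0 < L q" for q
  proof -
    have "0 < real (L q)" using Lge[of q] dN[of q] by linarith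
    then show ?thesis by simp
  qed
  define B where "B q m = {i \<in> {1..N}. m * L q < i $ q \<and> i $ q \<le> Suc m * L q}" for q m
  have BN: "B q m \<subseteq> {1..N}" for q m by (auto simp: B_def)
  define E where "E q m = {\<omega> \<in> space P. \<exists>a\<le>N. c < \<bar>\<Sum>i\<in>{1..a} \<inter> B q m. D i \<omega>\<bar>}" for q m
  note st = slab_tail[OF P F M D D2 trunc BN c0 K]
  have Em: "E q m \<in> events" for q m unfolding E_def by (rule st(1))
  have cardB: "real (card (B q m)) \<le> 3 * \<delta> * s" for q m
  proof -
    have "card (B q m) * N $ q \<le> L q * idx_size N" unfolding B_def by (rule card_slab)
    then have "real (card (B q m)) * real (N $ q) \<le> real (L q) * s"
      unfolding s_def by (metis of_nat_mono of_nat_mult)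
    also have "\<dots> \<le> 3 * \<delta> * real (N $ q) * s" using Lle[of q] s0 by (intro mult_right_mono) auto
    finally have "real (card (B q m)) * real (N $ q) \<le> (3 * \<delta> * s) * real (N $ q)"
      by (simp add: mult_ac)
    then show ?thesis using N0[of q] by simp
  qed
  have Ebound: "prob (E q m) \<le> \<delta> * R" for q m
  proof -
    have "prob (E q m) \<le> 4 ^ CARD('d) * (4 ^ CARD('d) * (card (B q m) * K\<^sup>2))\<^sup>2 / (c / 2) ^ 4
        + 4 ^ CARD('d) * (card (B q m) * e) / (c / 2)\<^sup>2"
      unfolding E_def by (rule st(2))
    also have "\<dots> \<le> \<delta> * R"
      unfolding c_def R_def using s0 \<kappa>0 cardB e by (intro slab_tail_scaled) auto
    finally show ?thesis .
  qed
  define U where "U = (\<Union>q. \<Union>m\<in>{..N $ q div L q}. E q m)"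
  have "prob U \<le> (\<Sum>q\<in>UNIV. prob (\<Union>m\<in>{..N $ q div L q}. E q m))"
    unfolding U_def using Em by (intro measure_UNION_le sets.finite_UN) auto
  also have "\<dots> \<le> (\<Sum>q\<in>(UNIV :: 'd set). R)"
  proof (rule sum_mono)
    fix q :: 'd
    have "prob (\<Union>m\<in>{..N $ q div L q}. E q m) \<le> (\<Sum>m\<in>{..N $ q div L q}. prob (E q m))"
      using Em by (intro measure_UNION_le) auto
    also have "\<dots> \<le> (\<Sum>m\<in>{..N $ q div L q}. \<delta> * R)"
      by (intro sum_mono Ebound)
    also have "\<dots> = (real (N $ q div L q) + 1) * (\<delta> * R)" by simp
    also have "\<dots> \<le> (1 / \<delta>) * (\<delta> * R)"
    proof (rule mult_right_mono)
      have "real (N $ q div L q) \<le> real (N $ q) / real (L q)" by (rule of_nat_div_le_of_nat)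
      also have "\<dots> \<le> real (N $ q) / (2 * \<delta> * real (N $ q))"
        using Lge[of q] L0[of q] N0[of q] \<delta> by (intro divide_left_mono) auto
      also have "\<dots> = 1 / (2 * \<delta>)" using N0[of q] by simp
      \<comment> \<open>The extra slab from counting m = 0 is absorbed because \<delta> is at most
        1/2.\<close>
      also have "\<dots> + 1 \<le> 1 / \<delta>" using \<delta> by (simp add: field_simps)
      finally show "real (N $ q div L q) + 1 \<le> 1 / \<delta>" by simp
      show "0 \<le> \<delta> * R" using \<delta> R0 by simp
    qed
    finally show "prob (\<Union>m\<in>{..N $ q div L q}. E q m) \<le> R" using \<delta> by simp
  qed
  finally have Ubound: "prob U \<le> CARD('d) * R" by simp
  have Um: "U \<in> events" unfolding U_def using Em by (intro sets.finite_UN) auto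
  let ?T = "{(s, t). s \<in> {0..1} \<and> t \<in> {0..1} \<and> infnorm (s - t) < \<delta>} :: ((real ^ 'd) \<times> (real ^ 'd)) set"
  let ?w = "\<lambda>\<omega>. (SUP (s, t) \<in> ?T. ereal (\<bar>M (idx_floor (idx_scale s N)) \<omega> - M (idx_floor (idx_scale t N)) \<omega>\<bar>
      / sqrt (real (idx_size N))))"
  have "?w \<omega> \<le> ereal \<epsilon>" if \<omega>: "\<omega> \<in> space P" "\<omega> \<notin> U" for \<omega>
  proof (rule SUP_least, clarify)
    fix x y :: "real ^ 'd"
    assume xy: "x \<in> {0..1}" "y \<in> {0..1}" "infnorm (x - y) < \<delta>"
    let ?f = "\<lambda>a. M a \<omega>"
    have slab: "\<bar>?f a - ?f (idx_upd a q (m * L q))\<bar> \<le> c"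
      if a: "a \<le> N" "m * L q \<le> a $ q" "a $ q \<le> Suc m * L q" for a q m
    proof -
      have "m * L q \<le> N $ q" using a(1,2) by (auto simp: less_eq_vec_def intro: order_trans)
      then have "m \<le> N $ q div L q" using L0[of q] by (simp add: less_eq_div_iff_mult_less_eq)
      then have "\<omega> \<notin> E q m" using \<omega>(2) unfolding U_def by blast
      then have "\<bar>\<Sum>i\<in>{1..a} \<inter> B q m. D i \<omega>\<bar> \<le> c" using \<omega>(1) a(1) unfolding E_def by (auto simp: not_less)
      also have "(\<Sum>i\<in>{1..a} \<inter> B q m. D i \<omega>) = ?f a - ?f (idx_upd a q (m * L q))"
        unfolding B_def orthomartingale_eq_sum[OF M D \<omega>(1)] by (rule slab_sum[OF a])
      finally show ?thesis .
    qed
    have "\<bar>?f (idx_floor (idx_scale x N)) - ?f (idx_floor (idx_scale y N))\<bar> \<le> CARD('d) * (3 * c)"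
    proof (rule grid_increment[where f = ?f and N = N and L = L, OF L0 slab])
      have "infnorm (y - x) < \<delta>" using xy(3) by (simp add: infnorm_sub)
      then show "idx_floor (idx_scale y N) $ q \<le> idx_floor (idx_scale x N) $ q + L q" for q
        unfolding L_def by (intro idx_floor_scale_diff xy N \<delta>)
    qed (auto simp: L_def intro!: idx_floor_scale_diff idx_floor_scale_le xy N \<delta>)
    also have "\<dots> = \<epsilon> * sqrt s" unfolding c_def \<kappa> by simp
    finally show "ereal (\<bar>?f (idx_floor (idx_scale x N)) - ?f (idx_floor (idx_scale y N))\<bar> / sqrt (real (idx_size N))) \<le> ereal \<epsilon>"
      using s0 unfolding s_def[symmetric] by (simp add: divide_le_eq)
  qed
  then have sub: "{\<omega> \<in> space P. ?w \<omega> > ereal \<epsilon>} \<subseteq> U"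
    by (auto simp: not_less[symmetric])
  \<comment> \<open>if the event on the left failed to be measurable, its measure would be 0\<close>
  have "prob {\<omega> \<in> space P. ?w \<omega> > ereal \<epsilon>} \<le> prob U"
  proof (cases "{\<omega> \<in> space P. ?w \<omega> > ereal \<epsilon>} \<in> events")
    case True
    then show ?thesis using sub Um by (intro finite_measure_mono)
  next
    case False
    then show ?thesis by (subst measure_notin_sets) auto
  qed
  also note Ubound
  finally show ?thesis unfolding R_def .
qed

section \<open>Passage to the limit\<close>

lemma eventually_idx_at_top:
  assumes "\<And>q. eventually (Q q) at_top"
  shows "eventually (\<lambda>n. \<forall>q. Q q (n $ q)) (idx_at_top :: (nat ^ 'd::finite) filter)"
proof (rule eventually_all_finite)
  fix q :: 'd
  have "eventually (\<lambda>n :: nat ^ 'd. Q q (n $ q)) (filtercomap (\<lambda>n. n $ q) at_top)"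
    using assms by (rule eventually_filtercomapI)
  moreover have "(idx_at_top :: (nat ^ 'd) filter) \<le> filtercomap (\<lambda>n. n $ q) at_top"
    unfolding idx_at_top_def by (rule INF_lower) simp
  ultimately show "eventually (\<lambda>n :: nat ^ 'd. Q q (n $ q)) idx_at_top"
    by (simp add: filter_leD)
qed

text \<open>The diagonal tends to infinity in every coordinate. Nontriviality is needed for the
  upper limit of nonnegative quantities to be nonnegative.\<close>

lemma idx_at_top_neq_bot: "idx_at_top \<noteq> (bot :: (nat ^ 'd::finite) filter)"
proof -
  have "filtermap (\<lambda>m. \<chi> q. m) at_top \<le> (idx_at_top :: (nat ^ 'd) filter)"
    unfolding idx_at_top_def
  proof (rule INF_greatest)
    fix q :: 'd
    show "filtermap (\<lambda>m. \<chi> q. m) at_top \<le> filtercomap (\<lambda>n :: nat ^ 'd. n $ q) at_top"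
      unfolding filtermap_le_iff_le_filtercomap filtercomap_filtercomap by (simp add: filtercomap_ident)
  qed
  moreover have "filtermap (\<lambda>m. \<chi> q. m) at_top \<noteq> (bot :: (nat ^ 'd) filter)"
    by (simp add: filtermap_bot_iff)
  ultimately show ?thesis by (metis bot.extremum_uniqueI)
qed

theorem proposition3p2:
  fixes P :: "'a measure"
    and F :: "nat ^ 'd::finite \<Rightarrow> 'a measure"
    and M D :: "nat ^ 'd \<Rightarrow> 'a \<Rightarrow> real"
  assumes "prob_space P"
    and "commuting_filtration P F"
    and "orthomartingale P F M"
    and "orthomartingale_differences P M D"
    and "strictly_stationary P D"
    and "integrable P (\<lambda>\<omega>. (D 1 \<omega>)\<^sup>2)"
  shows "\<forall>\<epsilon>>0.
    ((\<lambda>\<delta>::real. Limsup idx_at_top (\<lambda>n. ereal (measure P {\<omega> \<in> space P.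
        (SUP (s, t) \<in> {(s, t). s \<in> {0..1} \<and> t \<in> {0..1} \<and> infnorm (s - t) < \<delta>}.
           ereal (\<bar>M (idx_floor (idx_scale s n)) \<omega> - M (idx_floor (idx_scale t n)) \<omega>\<bar>
                  / sqrt (real (idx_size n)))) > ereal \<epsilon>})))
      \<longlongrightarrow> 0) (at_right 0)"
proof (intro allI impI)
  fix \<epsilon> :: real assume \<epsilon>: "\<epsilon> > 0"
  define p where "p \<delta> n = measure P {\<omega> \<in> space P.
        (SUP (s, t) \<in> {(s, t). s \<in> {0..1} \<and> t \<in> {0..1} \<and> infnorm (s - t) < \<delta>}.
           ereal (\<bar>M (idx_floor (idx_scale s n)) \<omega> - M (idx_floor (idx_scale t n)) \<omega>\<bar>
                  / sqrt (real (idx_size n)))) > ereal \<epsilon>}" for \<delta> :: real and n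
  have D2: "square_integrable P (D n)" if "1 \<le> n" for n
  proof -
    have Dm: "\<And>n. 1 \<le> n \<Longrightarrow> D n \<in> borel_measurable P"
      using assms(4) by (auto simp: orthomartingale_differences_def)
    from strictly_stationary_integral(2)[OF assms(5) this that, of "\<lambda>x. x\<^sup>2"] show ?thesis
      using assms(6) Dm[OF that] by (simp add: square_integrable_def)
  qed
  define \<kappa> where "\<kappa> = \<epsilon> / (3 * CARD('d))"
  have \<kappa>0: "\<kappa> > 0" using \<epsilon> by (simp add: \<kappa>_def)
  have small: "\<exists>b>0. \<forall>\<delta>>0. \<delta> < b \<longrightarrow> Limsup idx_at_top (\<lambda>n. ereal (p \<delta> n)) \<le> ereal \<gamma>" if \<gamma>: "\<gamma> > 0" for \<gamma> :: real
  proof -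
    define A where "A = CARD('d) * (12 * 4 ^ CARD('d) / \<kappa>\<^sup>2)"
    have A0: "A > 0" unfolding A_def using \<kappa>0 by (intro mult_pos_pos divide_pos_pos) auto
    \<comment> \<open>Half of \<gamma> goes to the remainder, through A e = \<gamma> / 2. Only then
      is K obtained, and with it C.\<close>
    define e where "e = \<gamma> / (2 * A)"
    have e0: "e > 0" unfolding e_def using \<gamma> A0 by simp
    obtain K :: real where K: "K > 0" "\<And>N n. n \<in> {1..N} \<Longrightarrow> \<exists>Y. Y \<in> borel_measurable (F n) \<and>
      (\<forall>\<omega>\<in>space P. \<bar>Y \<omega>\<bar> \<le> K) \<and> (\<forall>q. centered P (F (idx_upd N q (n $ q - 1))) Y) \<and>
      (\<integral>\<omega>. (D n \<omega> - Y \<omega>)\<^sup>2 \<partial>P) \<le> e"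
      using orthomartingale_differences_truncation[OF assms e0] by blast
    define C where "C = CARD('d) * (144 * (4 ^ CARD('d)) ^ 3 * K ^ 4 / \<kappa> ^ 4)"
    have C0: "C > 0" unfolding C_def using \<kappa>0 K(1) by (intro mult_pos_pos divide_pos_pos) auto
    \<comment> \<open>The first entry meets the condition on \<delta> in
      \<open>modulus_tail\<close>; the second leaves at most \<gamma> / 2 for C \<delta>.\<close>
    define b where "b = min (1 / 2) (\<gamma> / (2 * C))"
    have "Limsup idx_at_top (\<lambda>n. ereal (p \<delta> n)) \<le> ereal \<gamma>" if \<delta>: "0 < \<delta>" "\<delta> < b" for \<delta>
    proof (rule Limsup_bounded)
      have "eventually (\<lambda>m. 1 / \<delta> \<le> real m) at_top"
        using filterlim_real_sequentially by (simp add: filterlim_at_top)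
      then have "eventually (\<lambda>n :: nat ^ 'd. \<forall>q. 1 / \<delta> \<le> real (n $ q)) idx_at_top"
        by (intro eventually_idx_at_top)
      then show "eventually (\<lambda>n. ereal (p \<delta> n) \<le> ereal \<gamma>) idx_at_top"
      proof eventually_elim
        case (elim n)
        have "p \<delta> n \<le> CARD('d) * (144 * (4 ^ CARD('d)) ^ 3 * K ^ 4 / \<kappa> ^ 4 * \<delta> + 12 * 4 ^ CARD('d) / \<kappa>\<^sup>2 * e)"
          unfolding p_def
          using elim \<delta> K(1) e0 \<epsilon>
          by (intro modulus_tail[OF assms(1-4) D2 K(2)] \<kappa>_def) (auto simp: b_def)
        also have "\<dots> = C * \<delta> + A * e" unfolding C_def A_def by (simp add: algebra_simps)
        also have "C * \<delta> \<le> C * (\<gamma> / (2 * C))" using \<delta> C0 by (intro mult_left_mono) (auto simp: b_def)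
        also have "C * (\<gamma> / (2 * C)) + A * e = \<gamma>" unfolding e_def using A0 C0 by simp
        finally show ?case by simp
      qed
    qed
    moreover have "b > 0" unfolding b_def using \<gamma> C0 by simp
    ultimately show ?thesis by blast
  qed
  have "((\<lambda>\<delta>. Limsup idx_at_top (\<lambda>n. ereal (p \<delta> n))) \<longlongrightarrow> 0) (at_right 0)"
  proof (rule order_tendstoI)
    fix a :: ereal assume "a < 0"
    moreover have "0 \<le> Limsup idx_at_top (\<lambda>n. ereal (p \<delta> n))" for \<delta>
      by (rule le_Limsup[OF idx_at_top_neq_bot]) (simp add: p_def)
    ultimately show "eventually (\<lambda>\<delta>. a < Limsup idx_at_top (\<lambda>n. ereal (p \<delta> n))) (at_right 0)"
      by (intro always_eventually allI) (rule less_le_trans)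
  next
    fix a :: ereal assume "0 < a"
    then obtain \<gamma> where \<gamma>: "0 < ereal \<gamma>" "ereal \<gamma> < a" using ereal_dense2 by blast
    then obtain b where b: "b > 0" "\<And>\<delta>. 0 < \<delta> \<Longrightarrow> \<delta> < b \<Longrightarrow> Limsup idx_at_top (\<lambda>n. ereal (p \<delta> n)) \<le> ereal \<gamma>"
      using small[of \<gamma>] by auto
    then show "eventually (\<lambda>\<delta>. Limsup idx_at_top (\<lambda>n. ereal (p \<delta> n)) < a) (at_right 0)"
      unfolding eventually_at_right_field using \<gamma>(2) by (intro exI[of _ b]) (auto intro: le_less_trans)
  qed
  then show "((\<lambda>\<delta>::real. Limsup idx_at_top (\<lambda>n. ereal (measure P {\<omega> \<in> space P.
        (SUP (s, t) \<in> {(s, t). s \<in> {0..1} \<and> t \<in> {0..1} \<and> infnorm (s - t) < \<delta>}.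
           ereal (\<bar>M (idx_floor (idx_scale s n)) \<omega> - M (idx_floor (idx_scale t n)) \<omega>\<bar>
                  / sqrt (real (idx_size n)))) > ereal \<epsilon>})))
      \<longlongrightarrow> 0) (at_right 0)"
    unfolding p_def .
qed

end
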